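(* Let $L=3^8\,2^{3(n+1)+2}\lambda=O(2^{3n}\lambda)$. The verifiable tomography scheme $(\mathsf{Tomography},\mathsf{Verify})$ described in the context satisfies $(O(2^{-n}),L,\Pi,\mathcal D_x)$-distributional different-input correctness for every $x\in\{0,1\}^d$; that is, $$\Pr_{(\mathbf x,\mathbf x')\leftarrow\mathcal D_x}\left[\mathsf{Verify}\left(\mathbf x',\ \mathsf{Tomography}\left(\Phi_\lambda(\mathbf x)^{\otimes L}\right)\right)=\mathsf{Invalid}\right]\ge1-O(2^{-n}).$$
   Context: PRFS. A QPT algorithm $G$ is a (selectively secure) $(d,n)$-PRFS generator if $G_\lambda(k,x)$, for $k\in\{0,1\}^\lambda,x\in\{0,1\}^{d(\lambda)}$, is an $n(\lambda)$-qubit state, and for all polynomials $s,t$, all non-uniform QPT distinguishers $A$ (polynomial-size quantum circuits with quantum advice) and all families of sets of inputs $\{x_1,\dots,x_{s(\lambda)}\}\subseteq\{0,1\}^{d(\lambda)}$ there is a negligible $\varepsilon$ such that $A_\lambda$, given $x_1,\dots,x_s$, distinguishes $G_\lambda(k,x_1)^{\otimes t},\dots,G_\lambda(k,x_s)^{\otimes t}$ (for uniform $k$) from $|\vartheta_1\rangle^{\otimes t},\dots,|\vartheta_s\rangle^{\otimes t}$ (for independent Haar-random $n$-qubit states) with advantage at most $\varepsilon(\lambda)$. $G$ has the recognizable abort property if there are a QPT algorithm $\widehat G$ and an $(n+1)$-qubit state $|\bot\rangle=|1\rangle|\widehat\bot\rangle$ such that $\widehat G_\lambda(k,x)=\eta_{k,x}|0\rangle\langle0|\otimes|\psi_{k,x}\rangle\langle\psi_{k,x}|+(1-\eta_{k,x})|\bot\rangle\langle\bot|$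 with $\eta_{k,x}\in[0,1]$, $|\psi_{k,x}\rangle$ an $n$-qubit pure state, and $G_\lambda(k,x)$ is obtained from it by tracing out the first qubit. Setting. $d(\lambda)=\lceil\log\lambda/\log\log\lambda\rceil$, $n(\lambda)=\lceil3\log_2\lambda\rceil$, and $G$ is a $(d,n)$-PRFS generator with recognizable abort. $\mathcal P_n$ is the set of $4^n$ $n$-qubit Paulis (tensor products of $I,X,Y,Z$). For $P_x\in\mathcal P_n$, $k\in\{0,1\}^\lambda$, $x\in\{0,1\}^d$, $b\in\{0,1\}$, let $\Phi_\lambda(P_x,k,x,b)=(I\otimes P_x^b)\,\widehat G_\lambda(k,x)\,(I\otimes P_x^b)$. The predicate $\Pi((P_0,k_0,x_0,b_0),(P_1,k_1,x_1,b_1))$ equals $0$ if $P_0=P_1$, $x_0=x_1$ and $b_0\ne b_1$, and equals $1$ otherwise. $\mathcal D_x$ samples $P_x\leftarrow\mathcal P_n$ and $k_0,k_1\leftarrow\{0,1\}^\lambda$ independently and uniformly and outputs the pair $(\mathbf x,\mathbf x')=((P_x,k_0,x,0),(P_x,k_1,x,1))$ (which satisfies $\Pi(\mathbf x,\mathbf x')=0$). Tomography. $\mathcal T$ is a tomography procedure that given $sN^2$ copies of an $N$-dimensional density matrix $\rho$ outputs a matrix $M$ with $\mathbb E\|M-\rho\|_F^2\le N/s$ (such a procedure exists). $\mathcal T_{\rm imp}$, given $4sN^2\lambda$ copies of $\rho$, runs $\mathcal T(\rho^{\otimes4sN^2})$ independently $\lambda$ times to get $M_1,\dots,M_\lambda$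 and outputs some $M_{i^*}$ with $|\{j:\|M_j-M_{i^*}\|_F^2\le4N/s\}|>\lambda/2$, or a failure symbol if none exists. $\mathsf{Tomography}(\rho^{\otimes L})=\mathcal T_{\rm imp}(\rho^{\otimes L})$ with $N=2^{n+1}$, $s=3^82^{n+1}$. $\mathsf{Verify}(\mathbf x,M)$: compute $\widehat M\leftarrow\mathsf{Tomography}(\Phi_\lambda(\mathbf x)^{\otimes L})$; output $\mathsf{Invalid}$ if $\langle\bot|M|\bot\rangle>\frac19$; otherwise output $\mathsf{Valid}$ if $\|M-\widehat M\|_F^2\le\frac4{729}$ and $\mathsf{Invalid}$ otherwise (also $\mathsf{Invalid}$ upon failure symbols). $\|\cdot\|_F$ is the Frobenius norm. *)

theory Defs
  imports
    "HOL-Probability.Probability"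
    "HOL-Computational_Algebra.Polynomial"
    "HOL-Library.Landau_Symbols"
    "Jordan_Normal_Form.Schur_Decomposition"
begin

(* The security parameter is called lam throughout. HOL-Analysis and Jordan_Normal_Form both
   have constants mat and vec; the dimension-indexed ones of Jordan_Normal_Form are meant here,
   hence the qualified names and the disabled notation. *)

no_notation Finite_Cartesian_Product.vec_nth (infixl "$" 90)
no_notation Inner_Product.real_inner_class.inner (infix "\<bullet>" 70)

section \<open>Finite-dimensional quantum states\<close>

text \<open>The first tensor factor is the most significant one: basis index \<open>i * dim w + j\<close>
  of \<open>v \<otimes> w\<close> belongs to the pair \<open>(i, j)\<close>.\<close>

definition kron :: "complex mat \<Rightarrow> complex mat \<Rightarrow> complex mat" where
  "kron A B = Matrix.mat (dim_row A * dim_row B) (dim_col A * dim_col B)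
     (\<lambda>(i, j). A $$ (i div dim_row B, j div dim_col B) * B $$ (i mod dim_row B, j mod dim_col B))"

definition kron_vec :: "complex Matrix.vec \<Rightarrow> complex Matrix.vec \<Rightarrow> complex Matrix.vec" where
  "kron_vec v w = Matrix.vec (dim_vec v * dim_vec w) (\<lambda>i. v $ (i div dim_vec w) * w $ (i mod dim_vec w))"

definition kron_list :: "complex mat list \<Rightarrow> complex mat" where
  "kron_list As = foldr kron As (1\<^sub>m 1)"

definition tensor_power :: "complex mat \<Rightarrow> nat \<Rightarrow> complex mat" where
  "tensor_power A t = kron_list (replicate t A)"

definition mat_trace :: "complex mat \<Rightarrow> complex" where
  "mat_trace A = (\<Sum>i<dim_row A. A $$ (i, i))"

definition frob_norm :: "complex mat \<Rightarrow> real" where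
  "frob_norm A = sqrt (\<Sum>i<dim_row A. \<Sum>j<dim_col A. (cmod (A $$ (i, j)))\<^sup>2)"

text \<open>The order on complex numbers used here is the one of Jordan_Normal_Form: \<open>0 \<le> z\<close> says
  that \<open>z\<close> is real and nonnegative.\<close>

definition psd :: "nat \<Rightarrow> complex mat \<Rightarrow> bool" where
  "psd N A \<longleftrightarrow> A \<in> carrier_mat N N \<and> (\<forall>v \<in> carrier_vec N. 0 \<le> (A *\<^sub>v v) \<bullet>c v)"

definition density :: "nat \<Rightarrow> complex mat \<Rightarrow> bool" where
  "density N \<rho> \<longleftrightarrow> psd N \<rho> \<and> mat_trace \<rho> = 1"

definition pure_state :: "nat \<Rightarrow> complex Matrix.vec \<Rightarrow> bool" where
  "pure_state N v \<longleftrightarrow> v \<in> carrier_vec N \<and> v \<bullet>c v = 1"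

definition proj :: "complex Matrix.vec \<Rightarrow> complex mat" where
  "proj v = Matrix.mat (dim_vec v) (dim_vec v) (\<lambda>(i, j). v $ i * cnj (v $ j))"

definition unitary_mat :: "nat \<Rightarrow> complex mat \<Rightarrow> bool" where
  "unitary_mat N U \<longleftrightarrow> U \<in> carrier_mat N N \<and> U * mat_adjoint U = 1\<^sub>m N"

definition bit_ket :: "bool \<Rightarrow> complex Matrix.vec" where
  "bit_ket b = unit_vec 2 (of_bool b)"

definition classical_state :: "bool list \<Rightarrow> complex mat" where
  "classical_state w = kron_list (map (\<lambda>b. proj (bit_ket b)) w)"

text \<open>The operator \<open>A\<close> acts on \<open>\<complex>\<^sup>d \<otimes> \<complex>\<^sup>e\<close>.\<close>

definition trace_out_fst :: "nat \<Rightarrow> nat \<Rightarrow> complex mat \<Rightarrow> complex mat" where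
  "trace_out_fst d e A = Matrix.mat e e (\<lambda>(i, j). \<Sum>k<d. A $$ (k * e + i, k * e + j))"

definition trace_out_snd :: "nat \<Rightarrow> nat \<Rightarrow> complex mat \<Rightarrow> complex mat" where
  "trace_out_snd d e A = Matrix.mat d d (\<lambda>(i, j). \<Sum>k<e. A $$ (i * e + k, j * e + k))"

definition bitstrings :: "nat \<Rightarrow> bool list set" where
  "bitstrings m = {w. length w = m}"

section \<open>Quantum circuits and algorithms\<close>

text \<open>Generalized circuits over the universal gate set Hadamard, T, CNOT. Ancillas are appended
  after the input and initialized to zero; after the gates, the first \<open>qout\<close> qubits are
  the output and all others are traced out.\<close>

datatype gate = Hadamard nat | TGate nat | CNot nat nat

record qcircuit =
  qin :: nat
  qanc :: nat
  qout :: nat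
  qgates :: "gate list"

fun valid_gate :: "nat \<Rightarrow> gate \<Rightarrow> bool" where
  "valid_gate q (Hadamard i) \<longleftrightarrow> i < q"
| "valid_gate q (TGate i) \<longleftrightarrow> i < q"
| "valid_gate q (CNot i j) \<longleftrightarrow> i < q \<and> j < q \<and> i \<noteq> j"

definition valid_circuit :: "qcircuit \<Rightarrow> bool" where
  "valid_circuit C \<longleftrightarrow> qout C \<le> qin C + qanc C \<and> (\<forall>g \<in> set (qgates C). valid_gate (qin C + qanc C) g)"

definition circuit_size :: "qcircuit \<Rightarrow> nat" where
  "circuit_size C = length (qgates C) + qin C + qanc C + qout C"

definition hadamard_mat :: "complex mat" where
  "hadamard_mat = Matrix.mat 2 2 (\<lambda>(i, j). (if i = 1 \<and> j = 1 then -1 else 1) / complex_of_real (sqrt 2))"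

definition t_mat :: "complex mat" where
  "t_mat = Matrix.mat 2 2 (\<lambda>(i, j). if i \<noteq> j then 0 else if i = 0 then 1 else cis (pi / 4))"

definition on_qubit :: "nat \<Rightarrow> nat \<Rightarrow> complex mat \<Rightarrow> complex mat" where
  "on_qubit q i A = kron (1\<^sub>m (2 ^ i)) (kron A (1\<^sub>m (2 ^ (q - i - 1))))"

text \<open>Qubit \<open>i\<close> out of \<open>q\<close> is bit number \<open>q - 1 - i\<close> of a basis index.\<close>

fun gate_mat :: "nat \<Rightarrow> gate \<Rightarrow> complex mat" where
  "gate_mat q (Hadamard i) = on_qubit q i hadamard_mat"
| "gate_mat q (TGate i) = on_qubit q i t_mat"
| "gate_mat q (CNot i j) = Matrix.mat (2 ^ q) (2 ^ q)
     (\<lambda>(a, b). if a = (if bit b (q - 1 - i) then flip_bit (q - 1 - j) b else b) then 1 else 0)"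

definition circuit_unitary :: "nat \<Rightarrow> gate list \<Rightarrow> complex mat" where
  "circuit_unitary q gs = fold (\<lambda>g U. gate_mat q g * U) gs (1\<^sub>m (2 ^ q))"

definition run_circuit :: "qcircuit \<Rightarrow> complex mat \<Rightarrow> complex mat" where
  "run_circuit C \<rho> =
     (let q = qin C + qanc C; U = circuit_unitary q (qgates C) in
      trace_out_snd (2 ^ qout C) (2 ^ (q - qout C))
        (U * kron \<rho> (classical_state (replicate (qanc C) False)) * mat_adjoint U))"

definition poly_bounded :: "(nat \<Rightarrow> nat) \<Rightarrow> bool" where
  "poly_bounded f \<longleftrightarrow> (\<exists>p :: nat poly. \<forall>lam. f lam \<le> poly p lam)"

definition negligible :: "(nat \<Rightarrow> real) \<Rightarrow> bool" where
  "negligible \<epsilon> \<longleftrightarrow> (\<forall>c :: nat. \<forall>\<^sub>F lam in sequentially. \<bar>\<epsilon> lam\<bar> \<le> 1 / real lam ^ c)"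

text \<open>Deterministic Turing machines with one two-way infinite tape. States are \<open>{..<tm_states}\<close>
  with start state 0 and halting state 1; tape symbols are \<open>{..<tm_symbols}\<close>, where 0 is the
  blank and 1, 2 encode the bits.\<close>

record tm =
  tm_states :: nat
  tm_symbols :: nat
  tm_delta :: "nat \<Rightarrow> nat \<Rightarrow> nat \<times> nat \<times> int"

definition valid_tm :: "tm \<Rightarrow> bool" where
  "valid_tm M \<longleftrightarrow> 2 \<le> tm_states M \<and> 3 \<le> tm_symbols M \<and>
     (\<forall>q < tm_states M. \<forall>a < tm_symbols M.
        case tm_delta M q a of (q', a', m) \<Rightarrow> q' < tm_states M \<and> a' < tm_symbols M \<and> m \<in> {-1, 0, 1})"

type_synonym tm_config = "nat \<times> (int \<Rightarrow> nat) \<times> int"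

fun tm_step :: "tm \<Rightarrow> tm_config \<Rightarrow> tm_config" where
  "tm_step M (q, tape, h) =
     (if q = 1 then (q, tape, h)
      else case tm_delta M q (tape h) of (q', a', m) \<Rightarrow> (q', tape(h := a'), h + m))"

definition tape_of :: "bool list \<Rightarrow> int \<Rightarrow> nat" where
  "tape_of w i = (if 0 \<le> i \<and> nat i < length w then (if w ! nat i then 2 else 1) else 0)"

text \<open>On input \<open>1\<^sup>\<lambda>\<close> the output \<open>f \<lambda>\<close> is computed in time polynomial in \<open>\<lambda>\<close>.\<close>

definition poly_time_unary :: "(nat \<Rightarrow> bool list) \<Rightarrow> bool" where
  "poly_time_unary f \<longleftrightarrow> (\<exists>M (p :: nat poly). valid_tm M \<and>
     (\<forall>lam. \<exists>h. (tm_step M ^^ poly p lam) (0, tape_of (replicate lam True), 0) = (1, tape_of (f lam), h)))"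

definition encode_nat :: "nat \<Rightarrow> bool list" where
  "encode_nat m = replicate m True @ [False]"

fun encode_gate :: "gate \<Rightarrow> bool list" where
  "encode_gate (Hadamard i) = [False, False] @ encode_nat i"
| "encode_gate (TGate i) = [False, True] @ encode_nat i"
| "encode_gate (CNot i j) = [True, False] @ encode_nat i @ encode_nat j"

definition encode_circuit :: "qcircuit \<Rightarrow> bool list" where
  "encode_circuit C = encode_nat (qin C) @ encode_nat (qanc C) @ encode_nat (qout C) @
     concat (map encode_gate (qgates C))"

definition qpt :: "(nat \<Rightarrow> nat) \<Rightarrow> (nat \<Rightarrow> nat) \<Rightarrow> (nat \<Rightarrow> qcircuit) \<Rightarrow> bool" where
  "qpt m n C \<longleftrightarrow>
     (\<forall>lam. valid_circuit (C lam) \<and> qin (C lam) = m lam \<and> qout (C lam) = n lam) \<and>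
     poly_bounded (\<lambda>lam. circuit_size (C lam)) \<and>
     poly_time_unary (\<lambda>lam. encode_circuit (C lam))"

section \<open>Borel structures and Haar-random states\<close>

definition mat_borel :: "nat \<Rightarrow> complex mat measure" where
  "mat_borel N = vimage_algebra (carrier_mat N N)
     (\<lambda>M. \<lambda>p \<in> {..<N} \<times> {..<N}. M $$ p) (PiM ({..<N} \<times> {..<N}) (\<lambda>_. borel))"

definition vec_borel :: "nat \<Rightarrow> complex Matrix.vec measure" where
  "vec_borel N = vimage_algebra (carrier_vec N)
     (\<lambda>v. \<lambda>i \<in> {..<N}. v $ i) (PiM {..<N} (\<lambda>_. borel))"

text \<open>The Haar distribution on pure states is the unique unitarily invariant Borel probability
  measure concentrated on the unit sphere.\<close>

definition is_haar :: "nat \<Rightarrow> complex Matrix.vec measure \<Rightarrow> bool" where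
  "is_haar N \<mu> \<longleftrightarrow> prob_space \<mu> \<and> space \<mu> = space (vec_borel N) \<and> sets \<mu> = sets (vec_borel N) \<and>
     (AE v in \<mu>. pure_state N v) \<and>
     (\<forall>U. unitary_mat N U \<longrightarrow> distr \<mu> (vec_borel N) (\<lambda>v. U *\<^sub>v v) = \<mu>)"

definition haar :: "nat \<Rightarrow> complex Matrix.vec measure" where
  "haar N = (THE \<mu>. is_haar N \<mu>)"

section \<open>Pseudorandom function-like state generators\<close>

definition gen_out :: "(nat \<Rightarrow> qcircuit) \<Rightarrow> nat \<Rightarrow> bool list \<Rightarrow> bool list \<Rightarrow> complex mat" where
  "gen_out G lam k x = run_circuit (G lam) (kron (classical_state k) (classical_state x))"

text \<open>A non-uniform distinguisher is a polynomial-size family of circuits with advice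
  states \<open>adv\<close> of \<open>a lam\<close> qubits (polynomially many, as the input counts towards the size) and a
  single output qubit. It accepts when the output is measured to be 1.\<close>

definition distinguisher ::
    "(nat \<Rightarrow> nat) \<Rightarrow> (nat \<Rightarrow> nat) \<Rightarrow> (nat \<Rightarrow> qcircuit) \<Rightarrow> (nat \<Rightarrow> complex mat) \<Rightarrow> bool" where
  "distinguisher m a A adv \<longleftrightarrow>
     (\<forall>lam. valid_circuit (A lam) \<and> qin (A lam) = m lam + a lam \<and> qout (A lam) = 1 \<and>
            density (2 ^ a lam) (adv lam)) \<and>
     poly_bounded (\<lambda>lam. circuit_size (A lam))"

definition accept_prob ::
    "qcircuit \<Rightarrow> complex mat \<Rightarrow> bool list list \<Rightarrow> nat \<Rightarrow> complex mat list \<Rightarrow> real" where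
  "accept_prob C adv xs t \<rho>s =
     Re (run_circuit C (kron_list (map classical_state xs @ map (\<lambda>\<rho>. tensor_power \<rho> t) \<rho>s @ [adv])) $$ (1, 1))"

definition prfs_real ::
    "(nat \<Rightarrow> qcircuit) \<Rightarrow> nat \<Rightarrow> qcircuit \<Rightarrow> complex mat \<Rightarrow> bool list list \<Rightarrow> nat \<Rightarrow> real" where
  "prfs_real G lam C adv xs t =
     measure_pmf.expectation (pmf_of_set (bitstrings lam))
       (\<lambda>k. accept_prob C adv xs t (map (gen_out G lam k) xs))"

definition prfs_ideal :: "nat \<Rightarrow> qcircuit \<Rightarrow> complex mat \<Rightarrow> bool list list \<Rightarrow> nat \<Rightarrow> real" where
  "prfs_ideal n C adv xs t =
     (LINT \<theta> | PiM {..<length xs} (\<lambda>_. haar (2 ^ n)).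
        accept_prob C adv xs t (map (\<lambda>i. proj (\<theta> i)) [0..<length xs]))"

text \<open>The numbers of inputs and of copies range over polynomially bounded functions; the inputs
  form a set, so the list \<open>xs lam\<close> enumerating them is distinct.\<close>

definition prfs :: "(nat \<Rightarrow> nat) \<Rightarrow> (nat \<Rightarrow> nat) \<Rightarrow> (nat \<Rightarrow> qcircuit) \<Rightarrow> bool" where
  "prfs d n G \<longleftrightarrow> qpt (\<lambda>lam. lam + d lam) n G \<and>
     (\<forall>s t xs a A adv.
        poly_bounded s \<and> poly_bounded t \<and>
        (\<forall>lam. length (xs lam) = s lam \<and> distinct (xs lam) \<and> set (xs lam) \<subseteq> bitstrings (d lam)) \<and>
        distinguisher (\<lambda>lam. s lam * d lam + s lam * t lam * n lam) a A adv \<longrightarrow>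
        (\<exists>\<epsilon>. negligible \<epsilon> \<and>
           (\<forall>lam. \<bar>prfs_real G lam (A lam) (adv lam) (xs lam) (t lam)
                  - prfs_ideal (n lam) (A lam) (adv lam) (xs lam) (t lam)\<bar> \<le> \<epsilon> lam)))"

definition abort_state :: "complex Matrix.vec \<Rightarrow> complex Matrix.vec" where
  "abort_state bothat = kron_vec (bit_ket True) bothat"

text \<open>\<open>G\<close> has the recognizable abort property, witnessed by \<open>Ghat\<close> and \<open>|bothat\<rangle>\<close>.\<close>

definition recognizable_abort ::
    "(nat \<Rightarrow> nat) \<Rightarrow> (nat \<Rightarrow> nat) \<Rightarrow> (nat \<Rightarrow> qcircuit) \<Rightarrow> (nat \<Rightarrow> qcircuit) \<Rightarrow>
     (nat \<Rightarrow> complex Matrix.vec) \<Rightarrow> bool" where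
  "recognizable_abort d n G Ghat bothat \<longleftrightarrow>
     qpt (\<lambda>lam. lam + d lam) (\<lambda>lam. n lam + 1) Ghat \<and>
     (\<forall>lam. pure_state (2 ^ n lam) (bothat lam)) \<and>
     (\<forall>lam. \<forall>k \<in> bitstrings lam. \<forall>x \<in> bitstrings (d lam).
        (\<exists>\<eta> :: real. \<exists>\<psi>. 0 \<le> \<eta> \<and> \<eta> \<le> 1 \<and> pure_state (2 ^ n lam) \<psi> \<and>
           gen_out Ghat lam k x =
             complex_of_real \<eta> \<cdot>\<^sub>m kron (proj (bit_ket False)) (proj \<psi>)
             + complex_of_real (1 - \<eta>) \<cdot>\<^sub>m proj (abort_state (bothat lam))) \<and>
        gen_out G lam k x = trace_out_fst 2 (2 ^ n lam) (gen_out Ghat lam k x))"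

section \<open>Tomography\<close>

text \<open>Countable additivity of the operator-valued measure \<open>E\<close> on \<open>\<complex>\<^sup>D\<close> is
  stated entrywise; \<open>outcome\<close> is the Born rule.\<close>

definition povm :: "nat \<Rightarrow> 'o measure \<Rightarrow> ('o set \<Rightarrow> complex mat) \<Rightarrow> bool" where
  "povm D \<Omega> E \<longleftrightarrow>
     (\<forall>B \<in> sets \<Omega>. psd D (E B)) \<and> E (space \<Omega>) = 1\<^sub>m D \<and>
     (\<forall>B :: nat \<Rightarrow> 'o set. range B \<subseteq> sets \<Omega> \<and> disjoint_family B \<longrightarrow>
        (\<forall>i < D. \<forall>j < D. (\<lambda>m. E (B m) $$ (i, j)) sums (E (\<Union>m. B m) $$ (i, j))))"

definition outcome :: "'o measure \<Rightarrow> ('o set \<Rightarrow> complex mat) \<Rightarrow> complex mat \<Rightarrow> 'o measure" where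
  "outcome \<Omega> E \<rho> = measure_of (space \<Omega>) (sets \<Omega>) (\<lambda>B. ennreal (Re (mat_trace (E B * \<rho>))))"

text \<open>\<open>T N s\<close> is a measurement of \<open>s * N\<^sup>2\<close> systems of dimension \<open>N\<close>.\<close>

type_synonym tomography = "nat \<Rightarrow> nat \<Rightarrow> complex mat set \<Rightarrow> complex mat"

definition tomography_procedure :: "tomography \<Rightarrow> bool" where
  "tomography_procedure T \<longleftrightarrow> (\<forall>N \<ge> 1. \<forall>s \<ge> 1.
     povm (N ^ (s * N\<^sup>2)) (mat_borel N) (T N s) \<and>
     (\<forall>\<rho>. density N \<rho> \<longrightarrow>
        (\<integral>\<^sup>+ M. ennreal ((frob_norm (M - \<rho>))\<^sup>2) \<partial>outcome (mat_borel N) (T N s) (tensor_power \<rho> (s * N\<^sup>2)))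
          \<le> ennreal (real N / real s)))"

definition agrees_with_majority :: "nat \<Rightarrow> nat \<Rightarrow> nat \<Rightarrow> (nat \<Rightarrow> complex mat) \<Rightarrow> nat \<Rightarrow> bool" where
  "agrees_with_majority N s lam Ms i \<longleftrightarrow> i < lam \<and>
     real (card {j. j < lam \<and> (frob_norm (Ms j - Ms i))\<^sup>2 \<le> 4 * real N / real s}) > real lam / 2"

text \<open>\<open>sel N s lam Ms\<close> is the index \<open>i*\<close> picked among the admissible ones (if any); the choice
  is arbitrary up to measurability.\<close>

definition selection_rule :: "(nat \<Rightarrow> nat \<Rightarrow> nat \<Rightarrow> (nat \<Rightarrow> complex mat) \<Rightarrow> nat) \<Rightarrow> bool" where
  "selection_rule sel \<longleftrightarrow> (\<forall>N s lam.
     sel N s lam \<in> PiM {..<lam} (\<lambda>_. mat_borel N) \<rightarrow>\<^sub>M count_space UNIV \<and>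
     (\<forall>Ms \<in> space (PiM {..<lam} (\<lambda>_. mat_borel N)).
        (\<exists>i. agrees_with_majority N s lam Ms i) \<longrightarrow> agrees_with_majority N s lam Ms (sel N s lam Ms)))"

definition option_space :: "'o measure \<Rightarrow> 'o option measure" where
  "option_space \<Omega> = sigma (insert None (Some ` space \<Omega>))
     {A. A \<subseteq> insert None (Some ` space \<Omega>) \<and> Some -` A \<inter> space \<Omega> \<in> sets \<Omega>}"

text \<open>A supply of copies is a list of states standing for their tensor product. It is cut into
  \<open>lam\<close> blocks of \<open>4 * s * N\<^sup>2\<close> systems each, which are measured separately. The value
  \<open>None\<close> is the failure symbol.\<close>

definition block :: "nat \<Rightarrow> nat \<Rightarrow> 'a list \<Rightarrow> 'a list" where
  "block m i xs = take m (drop (i * m) xs)"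

definition tomography_imp ::
    "tomography \<Rightarrow> (nat \<Rightarrow> nat \<Rightarrow> nat \<Rightarrow> (nat \<Rightarrow> complex mat) \<Rightarrow> nat) \<Rightarrow> nat \<Rightarrow> nat \<Rightarrow> nat \<Rightarrow>
     complex mat list \<Rightarrow> complex mat option measure" where
  "tomography_imp T sel N s lam \<rho>s =
     distr (PiM {..<lam} (\<lambda>i. outcome (mat_borel N) (T N (4 * s)) (kron_list (block (4 * s * N\<^sup>2) i \<rho>s))))
       (option_space (mat_borel N))
       (\<lambda>Ms. if \<exists>i. agrees_with_majority N s lam Ms i then Some (Ms (sel N s lam Ms)) else None)"

section \<open>The verifiable tomography scheme\<close>

definition input_len :: "nat \<Rightarrow> nat" where
  "input_len lam = nat \<lceil>log 2 (real lam) / log 2 (log 2 (real lam))\<rceil>"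

definition output_len :: "nat \<Rightarrow> nat" where
  "output_len lam = nat \<lceil>3 * log 2 (real lam)\<rceil>"

definition num_copies :: "nat \<Rightarrow> nat" where
  "num_copies lam = 3 ^ 8 * 2 ^ (3 * (output_len lam + 1) + 2) * lam"

datatype pauli = PI | PX | PY | PZ

fun pauli1 :: "pauli \<Rightarrow> complex mat" where
  "pauli1 PI = 1\<^sub>m 2"
| "pauli1 PX = mat_of_rows_list 2 [[0, 1], [1, 0]]"
| "pauli1 PY = mat_of_rows_list 2 [[0, - \<i>], [\<i>, 0]]"
| "pauli1 PZ = mat_of_rows_list 2 [[1, 0], [0, -1]]"

text \<open>An \<open>n\<close>-qubit Pauli is given by its \<open>n\<close> tensor factors, on which its matrix
  depends injectively.\<close>

definition paulis :: "nat \<Rightarrow> pauli list set" where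
  "paulis n = {P. length P = n}"

definition pauli_mat :: "pauli list \<Rightarrow> complex mat" where
  "pauli_mat P = kron_list (map pauli1 P)"

type_synonym vt_input = "pauli list \<times> bool list \<times> bool list \<times> bool"

fun Phi :: "(nat \<Rightarrow> qcircuit) \<Rightarrow> nat \<Rightarrow> vt_input \<Rightarrow> complex mat" where
  "Phi Ghat lam (P, k, x, b) =
     (let V = kron (1\<^sub>m 2) (pauli_mat P ^\<^sub>m of_bool b) in V * gen_out Ghat lam k x * V)"

fun Pi_pred :: "vt_input \<Rightarrow> vt_input \<Rightarrow> nat" where
  "Pi_pred (P0, k0, x0, b0) (P1, k1, x1, b1) = (if P0 = P1 \<and> x0 = x1 \<and> b0 \<noteq> b1 then 0 else 1)"

definition D_dist :: "nat \<Rightarrow> bool list \<Rightarrow> (vt_input \<times> vt_input) pmf" where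
  "D_dist lam x = do {
     P \<leftarrow> pmf_of_set (paulis (output_len lam));
     k0 \<leftarrow> pmf_of_set (bitstrings lam);
     k1 \<leftarrow> pmf_of_set (bitstrings lam);
     return_pmf ((P, k0, x, False), (P, k1, x, True))
   }"

datatype verdict = Valid | Invalid

definition Tomography ::
    "tomography \<Rightarrow> (nat \<Rightarrow> nat \<Rightarrow> nat \<Rightarrow> (nat \<Rightarrow> complex mat) \<Rightarrow> nat) \<Rightarrow> nat \<Rightarrow>
     complex mat list \<Rightarrow> complex mat option measure" where
  "Tomography T sel lam = tomography_imp T sel (2 ^ (output_len lam + 1)) (3 ^ 8 * 2 ^ (output_len lam + 1)) lam"

text \<open>\<open>M\<close> need not be Hermitian, so the real part of \<open>\<langle>\<bottom>|M|\<bottom>\<rangle>\<close> is tested.\<close>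

fun verdict_of :: "complex Matrix.vec \<Rightarrow> complex mat option \<Rightarrow> complex mat option \<Rightarrow> verdict" where
  "verdict_of botv (Some M) (Some Mhat) =
     (if Re ((M *\<^sub>v botv) \<bullet>c botv) > 1 / 9 then Invalid
      else if (frob_norm (M - Mhat))\<^sup>2 \<le> 4 / 729 then Valid else Invalid)"
| "verdict_of botv _ _ = Invalid"

definition Verify ::
    "tomography \<Rightarrow> (nat \<Rightarrow> nat \<Rightarrow> nat \<Rightarrow> (nat \<Rightarrow> complex mat) \<Rightarrow> nat) \<Rightarrow> (nat \<Rightarrow> qcircuit) \<Rightarrow>
     (nat \<Rightarrow> complex Matrix.vec) \<Rightarrow> nat \<Rightarrow> vt_input \<Rightarrow> complex mat option \<Rightarrow> verdict measure" where
  "Verify T sel Ghat bothat lam z M =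
     distr (Tomography T sel lam (replicate (num_copies lam) (Phi Ghat lam z))) (count_space UNIV)
       (verdict_of (abort_state (bothat lam)) M)"

definition distributional_different_input_correct ::
    "(complex mat list \<Rightarrow> 'o measure) \<Rightarrow> ('i \<Rightarrow> 'o \<Rightarrow> verdict measure) \<Rightarrow> ('i \<Rightarrow> complex mat) \<Rightarrow>
     real \<Rightarrow> nat \<Rightarrow> ('i \<Rightarrow> 'i \<Rightarrow> nat) \<Rightarrow> ('i \<times> 'i) pmf \<Rightarrow> bool" where
  "distributional_different_input_correct Tom Ver \<Phi> \<epsilon> L rel D \<longleftrightarrow>
     (\<forall>(z, z') \<in> set_pmf D. rel z z' = 0) \<and>
     measure_pmf.expectation D
       (\<lambda>(z, z'). measure (Tom (replicate L (\<Phi> z)) \<bind> Ver z') {Invalid}) \<ge> 1 - \<epsilon>"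

end

theory Submission
  imports Defs "HOL-Real_Asymp.Real_Asymp"
begin

text \<open>Write \<open>\<psi>\<^sub>0\<close>, \<open>\<psi>\<^sub>1\<close> for the pure states produced from the keys \<open>k\<^sub>0\<close>, \<open>k\<^sub>1\<close>. Since the Paulis
  form an orthogonal basis of the matrices, the overlap \<open>|\<langle>\<psi>\<^sub>0|P|\<psi>\<^sub>1\<rangle>|\<^sup>2\<close> averages to \<open>2\<^sup>-\<^sup>n\<close> over a
  uniform Pauli \<open>P\<close>, for any two fixed states. If both tomography
  runs are \<open>1/27\<close>-accurate and the outcome is \<open>Valid\<close>, then comparing expectations in the state
  \<open>|0\<rangle>|\<psi>\<^sub>0\<rangle>\<close> shows that this overlap is at least \<open>19/27\<close>, which by Markov's inequality has probability
  \<open>O(2\<^sup>-\<^sup>n)\<close>. A run is inaccurate only if at least half of its \<open>\<lambda>\<close> independent estimates are off,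
  which has probability at most \<open>(7/8)\<^sup>\<lambda>\<close>, and this is \<open>O(2\<^sup>-\<^sup>n)\<close> because \<open>2\<^sup>n \<le> 2 \<lambda>\<^sup>3\<close>.\<close>

section \<open>Kronecker products and Hermitian matrices\<close>

text \<open>Conjugation by \<open>P\<close> moves the abort state too: the second state is a mixture
  of |0>P|psi_1> and |1>P|bothat>. The abort branch is harmless because the test state |0>|psi_0> is
  orthogonal to everything flagged 1. The abort test on the first estimate is what makes this test
  state informative: otherwise the first state could be almost entirely the abort state, with
  negligible weight on |0>|psi_0>. Failure symbols always give \<open>Invalid\<close>, so only
  estimates that are returned and wrong enter the error. Markov's inequality appears in linear form:
  for each \<open>P\<close> the rejection probability is at least 1 - 2(7/8)^lam - 2 overlap. This
  is vacuous when the overlap is 19/27 or more, and it can be averaged directly. The obstacle is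
  analytic: estimates range over a continuum of matrices, and both \<open>outcome\<close> and the
  monadic composition yield the intended measures only once countable additivity and joint
  measurability are established.\<close>

lemma sum_div_mod:
  fixes f :: "nat \<Rightarrow> nat \<Rightarrow> 'a :: comm_monoid_add"
  shows "(\<Sum>i<a * m. f (i div m) (i mod m)) = (\<Sum>i<a. \<Sum>j<m. f i j)"
proof -
  have "(\<Sum>i<a * m. f (i div m) (i mod m)) = (\<Sum>k<a. \<Sum>i = k * m..<k * m + m. f (i div m) (i mod m))"
    by (rule sum.nat_group [symmetric])
  also have "\<dots> = (\<Sum>i<a. \<Sum>j<m. f i j)"
  proof (rule sum.cong [OF refl])
    fix k
    have "(\<Sum>i = k * m..<k * m + m. f (i div m) (i mod m)) = (\<Sum>i = 0 + k * m..<m + k * m. f (i div m) (i mod m))"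
      by (simp add: add.commute)
    also have "\<dots> = (\<Sum>j = 0..<m. f ((j + k * m) div m) ((j + k * m) mod m))"
      by (rule sum.shift_bounds_nat_ivl)
    also have "\<dots> = (\<Sum>j<m. f k j)"
      by (rule sum.cong) auto
    finally show "(\<Sum>i = k * m..<k * m + m. f (i div m) (i mod m)) = (\<Sum>j<m. f k j)" .
  qed
  finally show ?thesis .
qed

lemma mod_less_of_less_mult: "i < a * m \<Longrightarrow> i mod m < (m :: nat)"
  by (metis gr_implies_not_zero mod_less_divisor mult_is_0 neq0_conv)

lemma dim_kron [simp]:
  "dim_row (kron A B) = dim_row A * dim_row B" "dim_col (kron A B) = dim_col A * dim_col B"
  by (simp_all add: kron_def)

lemma kron_carrier [intro]:
  "A \<in> carrier_mat m n \<Longrightarrow> B \<in> carrier_mat p q \<Longrightarrow> kron A B \<in> carrier_mat (m * p) (n * q)"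
  by (auto simp: kron_def)

lemma index_kron:
  "i < dim_row A * dim_row B \<Longrightarrow> j < dim_col A * dim_col B \<Longrightarrow>
   kron A B $$ (i, j) = A $$ (i div dim_row B, j div dim_col B) * B $$ (i mod dim_row B, j mod dim_col B)"
  by (simp add: kron_def)

lemma dim_kron_vec [simp]: "dim_vec (kron_vec v w) = dim_vec v * dim_vec w"
  by (simp add: kron_vec_def)

lemma kron_vec_carrier [intro]:
  "v \<in> carrier_vec m \<Longrightarrow> w \<in> carrier_vec n \<Longrightarrow> kron_vec v w \<in> carrier_vec (m * n)"
  by (auto simp: kron_vec_def)

lemma index_kron_vec:
  "i < dim_vec v * dim_vec w \<Longrightarrow> kron_vec v w $ i = v $ (i div dim_vec w) * w $ (i mod dim_vec w)"
  by (simp add: kron_vec_def)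

lemma dim_proj [simp]: "dim_row (proj v) = dim_vec v" "dim_col (proj v) = dim_vec v"
  by (simp_all add: proj_def)

lemma proj_carrier [intro]: "v \<in> carrier_vec n \<Longrightarrow> proj v \<in> carrier_mat n n"
  by (auto simp: proj_def)

lemma index_proj: "i < dim_vec v \<Longrightarrow> j < dim_vec v \<Longrightarrow> proj v $$ (i, j) = v $ i * cnj (v $ j)"
  by (simp add: proj_def)

lemma cscalar_prod_sum: "v \<bullet>c w = (\<Sum>i<dim_vec w. v $ i * cnj (w $ i))"
  by (simp add: scalar_prod_def lessThan_atLeast0 conjugate_complex_def)

lemma cscalar_prod_self: "v \<bullet>c v = complex_of_real (\<Sum>i<dim_vec v. (cmod (v $ i))\<^sup>2)"
  unfolding of_real_sum complex_norm_square by (rule cscalar_prod_sum)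

lemma mult_mat_vec_sum:
  "i < dim_row A \<Longrightarrow> dim_col A = dim_vec v \<Longrightarrow> (A *\<^sub>v v) $ i = (\<Sum>j<dim_vec v. A $$ (i, j) * v $ j)"
  by (simp add: scalar_prod_def lessThan_atLeast0)

lemma index_mult_mat_sum:
  "i < dim_row A \<Longrightarrow> j < dim_col B \<Longrightarrow> dim_col A = dim_row B \<Longrightarrow>
   (A * B) $$ (i, j) = (\<Sum>k<dim_row B. A $$ (i, k) * B $$ (k, j))"
  by (simp add: scalar_prod_def lessThan_atLeast0)

lemma kron_vec_cscalar_prod:
  assumes "dim_vec v = dim_vec v'" "dim_vec w = dim_vec w'"
  shows "kron_vec v w \<bullet>c kron_vec v' w' = (v \<bullet>c v') * (w \<bullet>c w')"
proof -
  have "kron_vec v w \<bullet>c kron_vec v' w' =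
      (\<Sum>i<dim_vec v' * dim_vec w'. (v $ (i div dim_vec w') * w $ (i mod dim_vec w')) *
         cnj (v' $ (i div dim_vec w') * w' $ (i mod dim_vec w')))"
    using assms by (simp add: cscalar_prod_sum index_kron_vec)
  also have "\<dots> = (\<Sum>i<dim_vec v'. \<Sum>j<dim_vec w'. (v $ i * w $ j) * cnj (v' $ i * w' $ j))"
    by (rule sum_div_mod)
  also have "\<dots> = (v \<bullet>c v') * (w \<bullet>c w')"
    by (simp add: cscalar_prod_sum sum_product mult_ac)
  finally show ?thesis .
qed

lemma kron_mult_vec:
  assumes "dim_col A = dim_vec v" "dim_col B = dim_vec w"
  shows "kron A B *\<^sub>v kron_vec v w = kron_vec (A *\<^sub>v v) (B *\<^sub>v w)"
proof (rule eq_vecI)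
  fix i assume "i < dim_vec (kron_vec (A *\<^sub>v v) (B *\<^sub>v w))"
  then have i: "i < dim_row A * dim_row B" by simp
  note i' = less_mult_imp_div_less [OF i] mod_less_of_less_mult [OF i]
  have "(kron A B *\<^sub>v kron_vec v w) $ i =
      (\<Sum>j<dim_vec v * dim_vec w. (A $$ (i div dim_row B, j div dim_vec w) * B $$ (i mod dim_row B, j mod dim_vec w))
        * (v $ (j div dim_vec w) * w $ (j mod dim_vec w)))"
    using i assms by (subst mult_mat_vec_sum) (auto simp: index_kron index_kron_vec intro!: sum.cong)
  also have "\<dots> = (\<Sum>j<dim_vec v. \<Sum>k<dim_vec w. (A $$ (i div dim_row B, j) * B $$ (i mod dim_row B, k)) * (v $ j * w $ k))"
    by (rule sum_div_mod)
  also have "\<dots> = kron_vec (A *\<^sub>v v) (B *\<^sub>v w) $ i"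
    using i i' assms by (simp add: index_kron_vec mult_mat_vec_sum sum_product mult_ac del: index_mult_mat_vec)
  finally show "(kron A B *\<^sub>v kron_vec v w) $ i = kron_vec (A *\<^sub>v v) (B *\<^sub>v w) $ i" .
qed simp

lemma kron_mult:
  assumes "dim_col A = dim_row C" "dim_col B = dim_row D"
  shows "kron A B * kron C D = kron (A * C) (B * D)"
proof (rule eq_matI)
  fix i j assume "i < dim_row (kron (A * C) (B * D))" "j < dim_col (kron (A * C) (B * D))"
  then have i: "i < dim_row A * dim_row B" and j: "j < dim_col C * dim_col D" by simp_all
  note ij = less_mult_imp_div_less [OF i] mod_less_of_less_mult [OF i]
    less_mult_imp_div_less [OF j] mod_less_of_less_mult [OF j]
  have "(kron A B * kron C D) $$ (i, j) =
      (\<Sum>k<dim_row C * dim_row D.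
        (A $$ (i div dim_row B, k div dim_row D) * B $$ (i mod dim_row B, k mod dim_row D))
        * (C $$ (k div dim_row D, j div dim_col D) * D $$ (k mod dim_row D, j mod dim_col D)))"
    using i j assms by (subst index_mult_mat_sum) (auto simp: index_kron intro!: sum.cong)
  also have "\<dots> = (\<Sum>k<dim_row C. \<Sum>l<dim_row D. (A $$ (i div dim_row B, k) * B $$ (i mod dim_row B, l))
        * (C $$ (k, j div dim_col D) * D $$ (l, j mod dim_col D)))"
    by (rule sum_div_mod)
  also have "\<dots> = kron (A * C) (B * D) $$ (i, j)"
    using i j ij assms by (simp add: index_kron index_mult_mat_sum sum_product mult_ac del: index_mult_mat(1))
  finally show "(kron A B * kron C D) $$ (i, j) = kron (A * C) (B * D) $$ (i, j)" .
qed simp_all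

lemma div_mod_eq_iff: "(i :: nat) = j \<longleftrightarrow> i div m = j div m \<and> i mod m = j mod m"
  by (metis div_mult_mod_eq)

lemma kron_one: "kron (1\<^sub>m m) (1\<^sub>m n) = 1\<^sub>m (m * n)"
proof (rule eq_matI)
  fix i j assume "i < dim_row (1\<^sub>m (m * n) :: complex mat)" "j < dim_col (1\<^sub>m (m * n) :: complex mat)"
  then have i: "i < m * n" and j: "j < m * n" by simp_all
  show "kron (1\<^sub>m m) (1\<^sub>m n) $$ (i, j) = 1\<^sub>m (m * n) $$ (i, j)"
    using i j less_mult_imp_div_less [OF i] mod_less_of_less_mult [OF i]
      less_mult_imp_div_less [OF j] mod_less_of_less_mult [OF j] div_mod_eq_iff [of i j n]
    by (auto simp: index_kron)
qed simp_all

lemma kron_proj: "kron (proj v) (proj w) = proj (kron_vec v w)"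
proof (rule eq_matI)
  fix i j assume "i < dim_row (proj (kron_vec v w))" "j < dim_col (proj (kron_vec v w))"
  then have i: "i < dim_vec v * dim_vec w" and j: "j < dim_vec v * dim_vec w" by simp_all
  then show "kron (proj v) (proj w) $$ (i, j) = proj (kron_vec v w) $$ (i, j)"
    using less_mult_imp_div_less [OF i] mod_less_of_less_mult [OF i]
      less_mult_imp_div_less [OF j] mod_less_of_less_mult [OF j]
    by (simp add: index_kron index_proj index_kron_vec)
qed simp_all

text \<open>For any matrix, A |v><v| followed by the adjoint of A gives |Av><Av|. Hermiticity lets
  \<open>A\<close> itself stand on the right, which is how \<open>Phi\<close> conjugates. It is
  stated entrywise because that form passes through the recursion over tensor factors.\<close>

lemma hermitian_conj_proj:
  assumes A: "A \<in> carrier_mat n n" and h: "\<And>i j. i < n \<Longrightarrow> j < n \<Longrightarrow> A $$ (j, i) = cnj (A $$ (i, j))"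
    and v: "v \<in> carrier_vec n"
  shows "A * proj v * A = proj (A *\<^sub>v v)"
proof (rule eq_matI)
  fix i j assume "i < dim_row (proj (A *\<^sub>v v))" "j < dim_col (proj (A *\<^sub>v v))"
  then have ij: "i < n" "j < n" using A by auto
  have "(A * proj v * A) $$ (i, j) = (\<Sum>l<n. (A * proj v) $$ (i, l) * A $$ (l, j))"
    using A v ij by (subst index_mult_mat_sum) auto
  also have "\<dots> = (\<Sum>l<n. (\<Sum>k<n. A $$ (i, k) * (v $ k * cnj (v $ l))) * A $$ (l, j))"
    using A v ij by (intro sum.cong refl, subst index_mult_mat_sum) (auto simp: index_proj)
  also have "\<dots> = (\<Sum>l<n. (\<Sum>k<n. A $$ (i, k) * v $ k) * (cnj (A $$ (j, l)) * cnj (v $ l)))"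
    using ij by (intro sum.cong refl) (simp add: h [symmetric] sum_distrib_right sum_distrib_left mult_ac)
  also have "\<dots> = (\<Sum>k<n. A $$ (i, k) * v $ k) * cnj (\<Sum>l<n. A $$ (j, l) * v $ l)"
    by (simp add: sum_distrib_left)
  also have "\<dots> = proj (A *\<^sub>v v) $$ (i, j)"
    using A v ij by (simp add: index_proj mult_mat_vec_sum del: index_mult_mat_vec)
  finally show "(A * proj v * A) $$ (i, j) = proj (A *\<^sub>v v) $$ (i, j)" .
qed (use A in auto)

lemma cscalar_prod_hermitian:
  assumes A: "A \<in> carrier_mat n n" and h: "\<And>i j. i < n \<Longrightarrow> j < n \<Longrightarrow> A $$ (j, i) = cnj (A $$ (i, j))"
    and v: "v \<in> carrier_vec n" and w: "w \<in> carrier_vec n"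
  shows "(A *\<^sub>v v) \<bullet>c w = v \<bullet>c (A *\<^sub>v w)"
proof -
  have "(A *\<^sub>v v) \<bullet>c w = (\<Sum>i<n. \<Sum>j<n. A $$ (i, j) * v $ j * cnj (w $ i))"
    using A v w by (simp add: cscalar_prod_sum mult_mat_vec_sum sum_distrib_right del: index_mult_mat_vec)
  also have "\<dots> = (\<Sum>j<n. \<Sum>i<n. A $$ (i, j) * v $ j * cnj (w $ i))"
    by (rule sum.swap)
  also have "\<dots> = (\<Sum>j<n. \<Sum>i<n. v $ j * cnj (A $$ (j, i) * w $ i))"
    by (intro sum.cong refl) (simp add: h [symmetric])
  also have "\<dots> = v \<bullet>c (A *\<^sub>v w)"
    using A v w by (simp add: cscalar_prod_sum mult_mat_vec_sum sum_distrib_left del: index_mult_mat_vec)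
  finally show ?thesis .
qed

section \<open>The Pauli twirl\<close>

lemma pauli1_carrier [simp]: "pauli1 p \<in> carrier_mat 2 2"
  by (cases p) (auto simp: mat_of_rows_list_def)

lemma dim_pauli1 [simp]: "dim_row (pauli1 p) = 2" "dim_col (pauli1 p) = 2"
  using pauli1_carrier [of p] by (auto simp del: pauli1_carrier)

lemma pauli_mat_Cons: "pauli_mat (p # P) = kron (pauli1 p) (pauli_mat P)"
  by (simp add: pauli_mat_def kron_list_def)

lemma pauli_mat_Nil: "pauli_mat [] = 1\<^sub>m 1"
  by (simp add: pauli_mat_def kron_list_def)

lemma dim_pauli_mat [simp]: "dim_row (pauli_mat P) = 2 ^ length P" "dim_col (pauli_mat P) = 2 ^ length P"
  by (induction P) (simp_all add: pauli_mat_Nil pauli_mat_Cons)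

lemma pauli_mat_carrier: "pauli_mat P \<in> carrier_mat (2 ^ length P) (2 ^ length P)"
  by auto

lemma less_two_cases: "(i :: nat) < 2 \<longleftrightarrow> i = 0 \<or> i = 1"
  by auto

lemma pauli1_hermitian: "i < 2 \<Longrightarrow> j < 2 \<Longrightarrow> pauli1 p $$ (j, i) = cnj (pauli1 p $$ (i, j))"
  by (cases p) (auto simp: less_two_cases mat_of_rows_list_def)

lemma pauli1_square: "pauli1 p * pauli1 p = 1\<^sub>m 2"
  by (rule eq_matI; cases p)
    (auto simp: less_two_cases mat_of_rows_list_def scalar_prod_def atLeast0_lessThan_Suc numeral_2_eq_2 less_Suc_eq)

lemma pauli_UNIV: "(UNIV :: pauli set) = {PI, PX, PY, PZ}"
  using pauli.exhaust by blast

lemma finite_pauli [simp]: "finite (A :: pauli set)"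
  by (rule finite_subset [OF subset_UNIV]) (simp add: pauli_UNIV)

text \<open>This is the completeness relation, dual to trace orthogonality: list the entries of each
  Pauli as a row of a 4 by 4 matrix; its columns are orthogonal with squared norm 2.\<close>

lemma pauli1_completeness:
  assumes "a < 2" "b < 2" "c < 2" "d < 2"
  shows "(\<Sum>p\<in>UNIV. pauli1 p $$ (a, b) * cnj (pauli1 p $$ (c, d))) = (if a = c \<and> b = d then 2 else 0)"
  using assms unfolding pauli_UNIV by (auto simp: less_two_cases mat_of_rows_list_def)

lemma pauli_mat_hermitian:
  "i < 2 ^ length P \<Longrightarrow> j < 2 ^ length P \<Longrightarrow> pauli_mat P $$ (j, i) = cnj (pauli_mat P $$ (i, j))"
proof (induction P arbitrary: i j)
  case Nil
  then show ?case by (simp add: pauli_mat_Nil)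
next
  case (Cons p P)
  then have i: "i < 2 * 2 ^ length P" and j: "j < 2 * 2 ^ length P" by simp_all
  show ?case
    using i j Cons.IH [OF mod_less_of_less_mult [OF i] mod_less_of_less_mult [OF j]]
      pauli1_hermitian [OF less_mult_imp_div_less [OF i] less_mult_imp_div_less [OF j], of p]
    by (simp add: pauli_mat_Cons index_kron)
qed

lemma pauli_mat_square: "pauli_mat P * pauli_mat P = 1\<^sub>m (2 ^ length P)"
  by (induction P) (simp_all add: pauli_mat_Nil pauli_mat_Cons kron_mult pauli1_square kron_one)

lemma paulis_0: "paulis 0 = {[]}"
  by (auto simp: paulis_def)

lemma paulis_Suc: "paulis (Suc n) = (\<lambda>(p, P). p # P) ` (UNIV \<times> paulis n)"
  by (auto simp: paulis_def length_Suc_conv image_iff)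

lemma finite_paulis [simp]: "finite (paulis n)"
  by (induction n) (simp_all add: paulis_0 paulis_Suc)

lemma card_paulis: "card (paulis n) = 4 ^ n"
proof (induction n)
  case (Suc n)
  have "card (paulis (Suc n)) = card (UNIV \<times> paulis n :: (pauli \<times> pauli list) set)"
    unfolding paulis_Suc by (rule card_image) (auto simp: inj_on_def)
  then show ?case using Suc by (simp add: card_cartesian_product pauli_UNIV)
qed (simp add: paulis_0)

lemma pauli_mat_completeness:
  assumes "a < 2 ^ n" "b < 2 ^ n" "c < 2 ^ n" "d < 2 ^ n"
  shows "(\<Sum>P\<in>paulis n. pauli_mat P $$ (a, b) * cnj (pauli_mat P $$ (c, d)))
    = (if a = c \<and> b = d then 2 ^ n else 0)"
  using assms
proof (induction n arbitrary: a b c d)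
  case 0
  then show ?case by (simp add: paulis_0 pauli_mat_Nil)
next
  case (Suc n)
  let ?m = "2 ^ n :: nat"
  from Suc.prems have lt: "a < 2 * ?m" "b < 2 * ?m" "c < 2 * ?m" "d < 2 * ?m" by simp_all
  have len: "length P = n" if "P \<in> paulis n" for P
    using that by (simp add: paulis_def)
  have "(\<Sum>P\<in>paulis (Suc n). pauli_mat P $$ (a, b) * cnj (pauli_mat P $$ (c, d))) =
    (\<Sum>(p, P)\<in>UNIV \<times> paulis n. pauli_mat (p # P) $$ (a, b) * cnj (pauli_mat (p # P) $$ (c, d)))"
    unfolding paulis_Suc by (subst sum.reindex) (auto simp: inj_on_def intro!: sum.cong)
  also have "\<dots> = (\<Sum>p\<in>UNIV. \<Sum>P\<in>paulis n. pauli_mat (p # P) $$ (a, b) * cnj (pauli_mat (p # P) $$ (c, d)))"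
    by (simp add: sum.cartesian_product)
  also have "\<dots> = (\<Sum>p\<in>UNIV. \<Sum>P\<in>paulis n.
      (pauli1 p $$ (a div ?m, b div ?m) * cnj (pauli1 p $$ (c div ?m, d div ?m))) *
      (pauli_mat P $$ (a mod ?m, b mod ?m) * cnj (pauli_mat P $$ (c mod ?m, d mod ?m))))"
    using lt len by (intro sum.cong refl) (simp add: pauli_mat_Cons index_kron)
  \<comment> \<open>The first tensor factor and the remaining ones range independently, so the sum
    splits into a product of the one-qubit relation and the induction hypothesis.\<close>
  also have "\<dots> = (\<Sum>p\<in>UNIV. pauli1 p $$ (a div ?m, b div ?m) * cnj (pauli1 p $$ (c div ?m, d div ?m))) *
      (\<Sum>P\<in>paulis n. pauli_mat P $$ (a mod ?m, b mod ?m) * cnj (pauli_mat P $$ (c mod ?m, d mod ?m)))"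
    by (simp only: sum_product)
  also have "\<dots> = (if a div ?m = c div ?m \<and> b div ?m = d div ?m then 2 else 0) *
      (if a mod ?m = c mod ?m \<and> b mod ?m = d mod ?m then 2 ^ n else 0)"
    using lt by (simp only: pauli1_completeness less_mult_imp_div_less Suc.IH mod_less_of_less_mult)
  also have "\<dots> = (if a = c \<and> b = d then 2 ^ Suc n else 0)"
    using div_mod_eq_iff [of a c ?m] div_mod_eq_iff [of b d ?m] by auto
  finally show ?case .
qed

text \<open>The hypothesis makes the columns of \<open>M\<close> orthogonal with squared norm
  \<open>K\<close>, so \<open>M\<close> multiplies every squared 2-norm by \<open>K\<close>.
  Expanding the square and summing over \<open>p\<close> innermost exposes the Gram entries of the
  columns.\<close>

lemma parseval_frame:
  fixes M :: "'p \<Rightarrow> 'x \<Rightarrow> complex" and K :: real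
  assumes J: "finite J"
    and orth: "\<And>x y. x \<in> J \<Longrightarrow> y \<in> J \<Longrightarrow> (\<Sum>p\<in>A. M p x * cnj (M p y)) = (if x = y then of_real K else 0)"
  shows "(\<Sum>p\<in>A. (cmod (\<Sum>x\<in>J. M p x * z x))\<^sup>2) = K * (\<Sum>x\<in>J. (cmod (z x))\<^sup>2)"
proof -
  have "complex_of_real (\<Sum>p\<in>A. (cmod (\<Sum>x\<in>J. M p x * z x))\<^sup>2) =
      (\<Sum>p\<in>A. (\<Sum>x\<in>J. M p x * z x) * cnj (\<Sum>x\<in>J. M p x * z x))"
    unfolding of_real_sum complex_norm_square ..
  also have "\<dots> = (\<Sum>p\<in>A. \<Sum>x\<in>J. \<Sum>y\<in>J. (M p x * z x) * cnj (M p y * z y))"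
    unfolding cnj_sum sum_product ..
  also have "\<dots> = (\<Sum>x\<in>J. \<Sum>y\<in>J. \<Sum>p\<in>A. (M p x * z x) * cnj (M p y * z y))"
    by (subst sum.swap, rule sum.cong [OF refl], rule sum.swap)
  also have "\<dots> = (\<Sum>x\<in>J. \<Sum>y\<in>J. (z x * cnj (z y)) * (\<Sum>p\<in>A. M p x * cnj (M p y)))"
    by (intro sum.cong refl) (simp add: sum_distrib_left mult_ac)
  also have "\<dots> = (\<Sum>x\<in>J. \<Sum>y\<in>J. if y = x then z x * cnj (z x) * of_real K else 0)"
    by (intro sum.cong refl) (simp add: orth)
  also have "\<dots> = (\<Sum>x\<in>J. z x * cnj (z x) * of_real K)"
    using J by (simp add: sum.delta)
  also have "\<dots> = complex_of_real (K * (\<Sum>x\<in>J. (cmod (z x))\<^sup>2))"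
    unfolding of_real_mult of_real_sum complex_norm_square sum_distrib_left by (simp add: mult_ac)
  finally show ?thesis by (simp only: of_real_eq_iff)
qed

text \<open>The overlap is linear in the entries of \<open>P\<close>, with coefficients forming the
  tensor product of the conjugate of \<open>w\<close> with \<open>v\<close>. Completeness lets
  \<open>parseval_frame\<close> apply with K = 2^n, and the squared norm of that tensor product is a
  product of two squared norms. Divided by the 4^n Paulis, this is the mean overlap 2^-n for unit
  vectors.\<close>

lemma pauli_twirl:
  assumes v: "v \<in> carrier_vec (2 ^ n)" and w: "w \<in> carrier_vec (2 ^ n)"
  shows "(\<Sum>P\<in>paulis n. (cmod ((pauli_mat P *\<^sub>v v) \<bullet>c w))\<^sup>2) = 2 ^ n * (Re (v \<bullet>c v) * Re (w \<bullet>c w))"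
proof -
  let ?I = "{..<2 ^ n :: nat}"
  have dims: "dim_vec v = 2 ^ n" "dim_vec w = 2 ^ n" using v w by auto
  have "(\<Sum>P\<in>paulis n. (cmod ((pauli_mat P *\<^sub>v v) \<bullet>c w))\<^sup>2) =
      (\<Sum>P\<in>paulis n. (cmod (\<Sum>x\<in>?I \<times> ?I. pauli_mat P $$ x * (cnj (w $ fst x) * v $ snd x)))\<^sup>2)"
  proof (rule sum.cong [OF refl])
    fix P assume "P \<in> paulis n"
    then have "length P = n" by (simp add: paulis_def)
    then have "(pauli_mat P *\<^sub>v v) \<bullet>c w = (\<Sum>a\<in>?I. \<Sum>b\<in>?I. pauli_mat P $$ (a, b) * (cnj (w $ a) * v $ b))"
      using dims by (simp add: cscalar_prod_sum mult_mat_vec_sum sum_distrib_right sum_distrib_left mult_ac del: index_mult_mat_vec)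
    then show "(cmod ((pauli_mat P *\<^sub>v v) \<bullet>c w))\<^sup>2 =
        (cmod (\<Sum>x\<in>?I \<times> ?I. pauli_mat P $$ x * (cnj (w $ fst x) * v $ snd x)))\<^sup>2"
      by (simp add: sum.cartesian_product case_prod_unfold)
  qed
  also have "\<dots> = 2 ^ n * (\<Sum>x\<in>?I \<times> ?I. (cmod (cnj (w $ fst x) * v $ snd x))\<^sup>2)"
    by (rule parseval_frame) (auto simp: pauli_mat_completeness split: if_splits)
  also have "(\<Sum>x\<in>?I \<times> ?I. (cmod (cnj (w $ fst x) * v $ snd x))\<^sup>2) =
      (\<Sum>a\<in>?I. \<Sum>b\<in>?I. (cmod (w $ a))\<^sup>2 * (cmod (v $ b))\<^sup>2)"
    by (simp add: sum.cartesian_product case_prod_unfold norm_mult power_mult_distrib)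
  also have "\<dots> = Re (v \<bullet>c v) * Re (w \<bullet>c w)"
    unfolding sum_product [symmetric] by (simp add: cscalar_prod_self dims mult.commute)
  finally show ?thesis .
qed

section \<open>Quadratic forms and the Frobenius norm\<close>

text \<open>The coordinate form makes linearity in the matrix a matter of rewriting finite sums. The
  real part mirrors the abort test, which is applied to estimates that need not be
  Hermitian.\<close>

definition qform :: "complex mat \<Rightarrow> complex Matrix.vec \<Rightarrow> real" where
  "qform A u = Re (\<Sum>i<dim_vec u. \<Sum>j<dim_vec u. A $$ (i, j) * u $ j * cnj (u $ i))"

lemma qform_eq:
  "A \<in> carrier_mat n n \<Longrightarrow> u \<in> carrier_vec n \<Longrightarrow> qform A u = Re ((A *\<^sub>v u) \<bullet>c u)"
  by (simp add: qform_def cscalar_prod_sum mult_mat_vec_sum sum_distrib_right del: index_mult_mat_vec)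

lemma qform_add:
  "A \<in> carrier_mat n n \<Longrightarrow> B \<in> carrier_mat n n \<Longrightarrow> u \<in> carrier_vec n \<Longrightarrow>
   qform (A + B) u = qform A u + qform B u"
  by (simp add: qform_def distrib_right sum.distrib)

lemma qform_diff:
  "A \<in> carrier_mat n n \<Longrightarrow> B \<in> carrier_mat n n \<Longrightarrow> u \<in> carrier_vec n \<Longrightarrow>
   qform (A - B) u = qform A u - qform B u"
  by (simp add: qform_def left_diff_distrib sum_subtractf)

lemma qform_smult:
  "A \<in> carrier_mat n n \<Longrightarrow> u \<in> carrier_vec n \<Longrightarrow> qform (complex_of_real c \<cdot>\<^sub>m A) u = c * qform A u"
  by (simp add: qform_def mult.assoc sum_distrib_left [symmetric] del: Re_sum)

lemma proj_quadratic:
  assumes "dim_vec u = dim_vec v"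
  shows "(\<Sum>i<dim_vec u. \<Sum>j<dim_vec u. proj v $$ (i, j) * u $ j * cnj (u $ i)) =
    complex_of_real ((cmod (v \<bullet>c u))\<^sup>2)"
proof -
  have "(\<Sum>i<dim_vec u. \<Sum>j<dim_vec u. proj v $$ (i, j) * u $ j * cnj (u $ i)) =
      (\<Sum>i<dim_vec u. \<Sum>j<dim_vec u. (v $ i * cnj (u $ i)) * cnj (v $ j * cnj (u $ j)))"
    using assms by (intro sum.cong refl) (simp add: index_proj mult_ac)
  then show ?thesis
    by (simp add: complex_norm_square cscalar_prod_sum sum_product del: of_real_power)
qed

lemma qform_proj: "dim_vec u = dim_vec v \<Longrightarrow> qform (proj v) u = (cmod (v \<bullet>c u))\<^sup>2"
  unfolding qform_def by (subst proj_quadratic) simp_all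

text \<open>Gives access to the Minkowski and Cauchy-Schwarz inequalities of
  \<open>L2_set\<close>.\<close>

lemma frob_norm_L2_set:
  "A \<in> carrier_mat n n \<Longrightarrow> frob_norm A = L2_set (\<lambda>x. cmod (A $$ x)) ({..<n} \<times> {..<n})"
  by (simp add: frob_norm_def L2_set_def sum.cartesian_product)

lemma frob_norm_minus_commute:
  "A \<in> carrier_mat n n \<Longrightarrow> B \<in> carrier_mat n n \<Longrightarrow> frob_norm (A - B) = frob_norm (B - A)"
  by (simp add: frob_norm_def norm_minus_commute)

lemma frob_norm_triangle:
  assumes "A \<in> carrier_mat n n" "B \<in> carrier_mat n n" "C \<in> carrier_mat n n"
  shows "frob_norm (A - C) \<le> frob_norm (A - B) + frob_norm (B - C)"
proof -
  let ?I = "{..<n} \<times> {..<n}"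
  have "frob_norm (A - C) = L2_set (\<lambda>x. cmod ((A - C) $$ x)) ?I"
    using assms by (intro frob_norm_L2_set minus_carrier_mat)
  also have "\<dots> \<le> L2_set (\<lambda>x. cmod ((A - B) $$ x) + cmod ((B - C) $$ x)) ?I"
  proof (rule L2_set_mono)
    fix x assume "x \<in> ?I"
    then have "(A - C) $$ x = (A - B) $$ x + (B - C) $$ x" using assms by auto
    then show "cmod ((A - C) $$ x) \<le> cmod ((A - B) $$ x) + cmod ((B - C) $$ x)"
      by (simp add: norm_triangle_ineq)
  qed simp
  also have "\<dots> \<le> L2_set (\<lambda>x. cmod ((A - B) $$ x)) ?I + L2_set (\<lambda>x. cmod ((B - C) $$ x)) ?I"
    by (rule L2_set_triangle_ineq)
  also have "\<dots> = frob_norm (A - B) + frob_norm (B - C)"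
    using assms by (intro arg_cong2 [where f = "(+)"] frob_norm_L2_set [symmetric] minus_carrier_mat)
  finally show ?thesis .
qed

lemma pure_stateD:
  assumes "pure_state n v"
  shows "v \<in> carrier_vec n" "dim_vec v = n" "v \<bullet>c v = 1" "(\<Sum>i<n. (cmod (v $ i))\<^sup>2) = 1"
proof -
  show v: "v \<in> carrier_vec n" "dim_vec v = n" "v \<bullet>c v = 1"
    using assms by (auto simp: pure_state_def)
  show "(\<Sum>i<n. (cmod (v $ i))\<^sup>2) = 1"
    using v(2,3) unfolding cscalar_prod_self by (simp only: of_real_eq_1_iff)
qed

text \<open>Cauchy-Schwarz for the entries of \<open>A\<close> against those of the rank-one
  projector onto \<open>u\<close>, whose Frobenius norm is 1. It turns Frobenius closeness of
  matrices into closeness of expectations.\<close>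

lemma abs_qform_le:
  assumes A: "A \<in> carrier_mat n n" and u: "pure_state n u"
  shows "\<bar>qform A u\<bar> \<le> frob_norm A"
proof -
  let ?I = "{..<n} \<times> {..<n}"
  note u' = pure_stateD [OF u]
  have "\<bar>qform A u\<bar> \<le> cmod (\<Sum>i<n. \<Sum>j<n. A $$ (i, j) * u $ j * cnj (u $ i))"
    unfolding qform_def u'(2) by (rule abs_Re_le_cmod)
  also have "\<dots> = cmod (\<Sum>x\<in>?I. A $$ x * (u $ snd x * cnj (u $ fst x)))"
    by (simp add: sum.cartesian_product case_prod_unfold mult.assoc)
  also have "\<dots> \<le> (\<Sum>x\<in>?I. \<bar>cmod (A $$ x)\<bar> * \<bar>cmod (u $ snd x * cnj (u $ fst x))\<bar>)"
    by (rule norm_sum [THEN order_trans]) (simp add: norm_mult)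
  also have "\<dots> \<le> L2_set (\<lambda>x. cmod (A $$ x)) ?I * L2_set (\<lambda>x. cmod (u $ snd x * cnj (u $ fst x))) ?I"
    by (rule L2_set_mult_ineq)
  also have "L2_set (\<lambda>x. cmod (u $ snd x * cnj (u $ fst x))) ?I =
      sqrt (\<Sum>i<n. \<Sum>j<n. (cmod (u $ i))\<^sup>2 * (cmod (u $ j))\<^sup>2)"
    by (simp add: L2_set_def sum.cartesian_product case_prod_unfold norm_mult power_mult_distrib mult.commute)
  also have "\<dots> = 1"
    unfolding sum_product [symmetric] u'(4) by simp
  finally show ?thesis using A by (simp add: frob_norm_L2_set)
qed

text \<open>With tomography errors at most \<open>1/27\<close>, the abort test on \<open>M\<close> forces \<open>\<eta> \<ge> 23/27\<close>, and the
  closeness test compares the expectations of \<open>\<rho>\<close> and \<open>\<sigma>\<close> in the state \<open>u\<close>.\<close>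

lemma valid_imp_overlap:
  assumes car: "M \<in> carrier_mat n n" "M' \<in> carrier_mat n n" "\<rho> \<in> carrier_mat n n" "\<sigma> \<in> carrier_mat n n"
    and u: "pure_state n u" and b: "pure_state n b"
    and valid: "verdict_of b (Some M) (Some M') = Valid"
    and err: "frob_norm (M - \<rho>) \<le> 1 / 27" "frob_norm (M' - \<sigma>) \<le> 1 / 27"
    and \<rho>: "qform \<rho> u = \<eta>" "qform \<rho> b = 1 - \<eta>"
  shows "19 / 27 \<le> qform \<sigma> u"
proof -
  from valid have q: "Re ((M *\<^sub>v b) \<bullet>c b) \<le> 1 / 9" and f: "(frob_norm (M - M'))\<^sup>2 \<le> 4 / 729"
    by (auto split: if_splits)
  have "(frob_norm (M - M'))\<^sup>2 \<le> (2 / 27)\<^sup>2" using f by (simp add: power2_eq_square)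
  then have f': "frob_norm (M - M') \<le> 2 / 27" by (rule power2_le_imp_le) simp
  note ub = pure_stateD(1) [OF u] pure_stateD(1) [OF b]
  have "qform M b \<le> 1 / 9" using q qform_eq [OF car(1) ub(2)] by simp
  moreover have "\<bar>qform M b - qform \<rho> b\<bar> \<le> frob_norm (M - \<rho>)"
    "\<bar>qform M u - qform \<rho> u\<bar> \<le> frob_norm (M - \<rho>)"
    "\<bar>qform M u - qform M' u\<bar> \<le> frob_norm (M - M')"
    "\<bar>qform M' u - qform \<sigma> u\<bar> \<le> frob_norm (M' - \<sigma>)"
    using abs_qform_le [of "M - \<rho>" n u] abs_qform_le [of "M - \<rho>" n b] abs_qform_le [of "M - M'" n u]
      abs_qform_le [of "M' - \<sigma>" n u] car u b
    by (simp_all add: minus_carrier_mat qform_diff [OF _ _ ub(1)] qform_diff [OF _ _ ub(2)])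
  \<comment> \<open>In the state \<open>b\<close>: 1 - \<eta> \<le> 1/9 + 1/27 = 4/27. In the state
    \<open>u\<close>, passing from \<rho> through \<open>M\<close> and \<open>M'\<close> to \<sigma>
    costs at most 1/27 + 2/27 + 1/27, which leaves 23/27 - 4/27.\<close>
  ultimately show ?thesis using \<rho> err f' by linarith
qed

section \<open>Sums of rank-one positive operators\<close>

text \<open>For such sums, closure under Kronecker products and positivity of the Born probabilities hold
  without an appeal to the spectral theorem.\<close>

inductive proj_sum :: "nat \<Rightarrow> complex mat \<Rightarrow> bool" for n where
  zero: "proj_sum n (0\<^sub>m n n)"
| add_proj: "v \<in> carrier_vec n \<Longrightarrow> proj_sum n A \<Longrightarrow> proj_sum n (proj v + A)"

lemma proj_sum_carrier: "proj_sum n A \<Longrightarrow> A \<in> carrier_mat n n"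
  by (induction rule: proj_sum.induct) auto

lemma proj_sum_proj: "v \<in> carrier_vec n \<Longrightarrow> proj_sum n (proj v)"
  using add_proj [OF _ zero, of v n] right_add_zero_mat [OF proj_carrier [of v n]] by simp

lemma proj_sum_add: "proj_sum n A \<Longrightarrow> proj_sum n B \<Longrightarrow> proj_sum n (A + B)"
proof (induction rule: proj_sum.induct)
  case zero
  then show ?case using proj_sum_carrier [of n B] by simp
next
  case (add_proj v A)
  have "proj v + A + B = proj v + (A + B)"
    using add_proj by (intro assoc_add_mat) (auto dest: proj_sum_carrier)
  then show ?case using add_proj proj_sum.add_proj [of v n "A + B"] by simp
qed

text \<open>A nonnegative weight is absorbed into the vector through its square root, so weighted
  mixtures are sums of unweighted rank-one terms.\<close>

lemma proj_smult_vec: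
  assumes "0 \<le> c"
  shows "complex_of_real c \<cdot>\<^sub>m proj v = proj (complex_of_real (sqrt c) \<cdot>\<^sub>v v)"
proof -
  have "complex_of_real c = complex_of_real (sqrt c) * complex_of_real (sqrt c)"
    using assms by (simp flip: of_real_mult)
  then show ?thesis by (intro eq_matI) (simp_all add: index_proj)
qed

lemma proj_sum_smult: "0 \<le> c \<Longrightarrow> v \<in> carrier_vec n \<Longrightarrow> proj_sum n (complex_of_real c \<cdot>\<^sub>m proj v)"
  by (simp add: proj_smult_vec proj_sum_proj)

lemma kron_add_left:
  "A \<in> carrier_mat m n \<Longrightarrow> B \<in> carrier_mat m n \<Longrightarrow> kron (A + B) C = kron A C + kron B C"
  by (rule eq_matI) (auto simp: index_kron less_mult_imp_div_less distrib_right)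

lemma kron_add_right:
  "A \<in> carrier_mat m n \<Longrightarrow> B \<in> carrier_mat m n \<Longrightarrow> kron C (A + B) = kron C A + kron C B"
  by (rule eq_matI) (auto simp: index_kron mod_less_of_less_mult distrib_left)

lemma kron_zero_left: "kron (0\<^sub>m m n) C = 0\<^sub>m (m * dim_row C) (n * dim_col C)"
  by (rule eq_matI) (auto simp: index_kron less_mult_imp_div_less)

lemma kron_zero_right: "kron C (0\<^sub>m m n) = 0\<^sub>m (dim_row C * m) (dim_col C * n)"
  by (rule eq_matI) (auto simp: index_kron mod_less_of_less_mult)

text \<open>Bilinear expansion by two nested inductions: a Kronecker product of two rank-one terms
  is the rank-one term of the product vector.\<close>

lemma proj_sum_kron:
  assumes "proj_sum m A" "proj_sum n B"
  shows "proj_sum (m * n) (kron A B)"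
  using assms(1)
proof (induction rule: proj_sum.induct)
  case zero
  then show ?case using proj_sum_carrier [OF assms(2)] by (simp add: kron_zero_left proj_sum.zero)
next
  case (add_proj v A)
  note v = add_proj(1)
  have "proj_sum (m * n) (kron (proj v) B)"
    using assms(2)
  proof (induction rule: proj_sum.induct)
    case zero
    then show ?case using v by (simp add: kron_zero_right proj_sum.zero)
  next
    case (add_proj w B)
    then have "kron (proj v) (proj w + B) = proj (kron_vec v w) + kron (proj v) B"
      using proj_sum_carrier [of n B] by (simp add: kron_add_right [OF proj_carrier] kron_proj)
    then show ?case using v add_proj by (simp add: kron_vec_carrier proj_sum.add_proj)
  qed
  moreover have "kron (proj v + A) B = kron (proj v) B + kron A B"
    using add_proj proj_sum_carrier [of m A] by (simp add: kron_add_left [OF proj_carrier])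
  ultimately show ?case using add_proj by (simp add: proj_sum_add)
qed

lemma proj_sum_one: "proj_sum 1 (1\<^sub>m 1)"
proof -
  have "1\<^sub>m 1 = proj (unit_vec 1 0)" by (rule eq_matI) (auto simp: index_proj)
  then show ?thesis by (simp add: proj_sum_proj)
qed

lemma tensor_power_0: "tensor_power A 0 = 1\<^sub>m 1"
  by (simp add: tensor_power_def kron_list_def)

lemma tensor_power_Suc: "tensor_power A (Suc t) = kron A (tensor_power A t)"
  by (simp add: tensor_power_def kron_list_def)

lemma proj_sum_tensor_power: "proj_sum n A \<Longrightarrow> proj_sum (n ^ t) (tensor_power A t)"
  by (induction t) (use proj_sum_one proj_sum_kron in \<open>simp_all add: tensor_power_0 tensor_power_Suc\<close>)

section \<open>Traces and nonnegativity of Born probabilities\<close>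

lemma mat_trace_kron:
  assumes "A \<in> carrier_mat m m" "B \<in> carrier_mat n n"
  shows "mat_trace (kron A B) = mat_trace A * mat_trace B"
proof -
  have "mat_trace (kron A B) = (\<Sum>i<m * n. A $$ (i div n, i div n) * B $$ (i mod n, i mod n))"
    using assms by (simp add: mat_trace_def index_kron)
  also have "\<dots> = (\<Sum>i<m. \<Sum>j<n. A $$ (i, i) * B $$ (j, j))"
    by (rule sum_div_mod)
  finally show ?thesis using assms by (simp add: mat_trace_def sum_product)
qed

lemma tensor_power_carrier: "A \<in> carrier_mat n n \<Longrightarrow> tensor_power A t \<in> carrier_mat (n ^ t) (n ^ t)"
  by (induction t) (auto simp: tensor_power_0 tensor_power_Suc)

lemma mat_trace_tensor_power: "A \<in> carrier_mat n n \<Longrightarrow> mat_trace (tensor_power A t) = mat_trace A ^ t"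
proof (induction t)
  case 0
  then show ?case by (simp add: tensor_power_0 mat_trace_def)
next
  case (Suc t)
  then show ?case by (simp add: tensor_power_Suc mat_trace_kron [OF _ tensor_power_carrier])
qed

lemma mat_trace_add:
  "A \<in> carrier_mat n n \<Longrightarrow> B \<in> carrier_mat n n \<Longrightarrow> mat_trace (A + B) = mat_trace A + mat_trace B"
  by (simp add: mat_trace_def sum.distrib)

lemma mat_trace_smult: "A \<in> carrier_mat n n \<Longrightarrow> mat_trace (c \<cdot>\<^sub>m A) = c * mat_trace A"
  by (simp add: mat_trace_def sum_distrib_left)

lemma mat_trace_proj: "mat_trace (proj v) = v \<bullet>c v"
  by (simp add: mat_trace_def cscalar_prod_sum index_proj)

lemma mat_trace_mult_proj:
  assumes "A \<in> carrier_mat n n" "v \<in> carrier_vec n"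
  shows "mat_trace (A * proj v) = (A *\<^sub>v v) \<bullet>c v"
proof -
  have "mat_trace (A * proj v) = (\<Sum>i<n. \<Sum>j<n. A $$ (i, j) * (v $ j * cnj (v $ i)))"
    using assms by (simp add: mat_trace_def index_mult_mat_sum index_proj del: index_mult_mat(1))
  then show ?thesis
    using assms by (simp add: cscalar_prod_sum mult_mat_vec_sum sum_distrib_right mult.assoc del: index_mult_mat_vec)
qed

lemma proj_sum_psd: "proj_sum n A \<Longrightarrow> psd n A"
proof (induction rule: proj_sum.induct)
  case zero
  have "(0\<^sub>m n n *\<^sub>v v) \<bullet>c v = 0" if "v \<in> carrier_vec n" for v :: "complex Matrix.vec"
    using that by (simp add: cscalar_prod_sum mult_mat_vec_sum del: index_mult_mat_vec)
  then show ?case by (simp add: psd_def)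
next
  case (add_proj v A)
  have "0 \<le> ((proj v + A) *\<^sub>v u) \<bullet>c u" if u: "u \<in> carrier_vec n" for u
  proof -
    have A: "A \<in> carrier_mat n n" using add_proj by (simp add: psd_def)
    have "((proj v + A) *\<^sub>v u) \<bullet>c u = (proj v *\<^sub>v u) \<bullet>c u + (A *\<^sub>v u) \<bullet>c u"
      using add_proj(1) A u by (simp add: cscalar_prod_sum mult_mat_vec_sum distrib_right sum.distrib del: index_mult_mat_vec)
    also have "(proj v *\<^sub>v u) \<bullet>c u = complex_of_real ((cmod (v \<bullet>c u))\<^sup>2)"
      using add_proj(1) u
      by (subst proj_quadratic [symmetric])
        (simp_all add: cscalar_prod_sum mult_mat_vec_sum sum_distrib_right del: index_mult_mat_vec)
    finally show ?thesis
      using add_proj.IH u by (auto simp: psd_def less_eq_complex_def)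
  qed
  then show ?case using add_proj by (auto simp: psd_def)
qed

text \<open>A rank-one summand of \<open>A\<close> with vector v contributes <v|E|v>, which is
  nonnegative as \<open>E\<close> is positive semidefinite.\<close>

lemma psd_trace_nonneg:
  assumes E: "psd n E" and "proj_sum n A"
  shows "0 \<le> Re (mat_trace (E * A))"
  using assms(2)
proof (induction rule: proj_sum.induct)
  case zero
  have "E * 0\<^sub>m n n = 0\<^sub>m n n" using E by (auto simp: psd_def)
  then show ?case by (simp add: mat_trace_def)
next
  case (add_proj v A)
  have car: "E \<in> carrier_mat n n" "A \<in> carrier_mat n n" using E add_proj proj_sum_carrier by (auto simp: psd_def)
  have "mat_trace (E * (proj v + A)) = mat_trace (E * proj v) + mat_trace (E * A)"
    using car add_proj(1) proj_carrier [of v n]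
    by (subst mult_add_distrib_mat) (auto simp: mat_trace_add [where n = n])
  moreover have "0 \<le> Re (mat_trace (E * proj v))"
    using E add_proj(1) by (auto simp: mat_trace_mult_proj [OF car(1)] psd_def less_eq_complex_def)
  ultimately show ?case using add_proj by simp
qed

section \<open>Measurability\<close>

lemma space_mat_borel [simp]: "space (mat_borel N) = carrier_mat N N"
  by (simp add: mat_borel_def)

lemma measurable_mat_index:
  assumes "i < N" "j < N"
  shows "(\<lambda>M. M $$ (i, j)) \<in> borel_measurable (mat_borel N)"
proof -
  let ?I = "{..<N} \<times> {..<N}"
  have "(\<lambda>M. \<lambda>p\<in>?I. M $$ p) \<in> mat_borel N \<rightarrow>\<^sub>M PiM ?I (\<lambda>_. borel :: complex measure)"
    unfolding mat_borel_def by (rule measurable_vimage_algebra1) (auto simp: space_PiM)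
  moreover have "(\<lambda>f. f (i, j)) \<in> PiM ?I (\<lambda>_. borel :: complex measure) \<rightarrow>\<^sub>M borel"
    using assms by (intro measurable_component_singleton) auto
  ultimately have "(\<lambda>M. (\<lambda>p\<in>?I. M $$ p) (i, j)) \<in> borel_measurable (mat_borel N)"
    by (rule measurable_compose)
  then show ?thesis using assms by simp
qed

lemma measurable_frob_norm_diff [measurable]:
  assumes f: "f \<in> \<Omega> \<rightarrow>\<^sub>M mat_borel N" and g: "g \<in> \<Omega> \<rightarrow>\<^sub>M mat_borel N"
  shows "(\<lambda>x. frob_norm (f x - g x)) \<in> borel_measurable \<Omega>"
proof -
  have [measurable]: "(\<lambda>x. f x $$ (i, j)) \<in> borel_measurable \<Omega>" "(\<lambda>x. g x $$ (i, j)) \<in> borel_measurable \<Omega>"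
    if "i < N" "j < N" for i j
    using measurable_compose [OF f measurable_mat_index [OF that]]
      measurable_compose [OF g measurable_mat_index [OF that]] by simp_all
  have "(\<lambda>x. sqrt (\<Sum>i<N. \<Sum>j<N. (cmod (f x $$ (i, j) - g x $$ (i, j)))\<^sup>2)) \<in> borel_measurable \<Omega>"
    by (intro measurable_compose [OF _ borel_measurable_sqrt] borel_measurable_sum borel_measurable_power
        measurable_compose [OF _ borel_measurable_norm] borel_measurable_diff) simp_all
  \<comment> \<open>\<open>frob_norm\<close> reads the summation bounds off its argument; these
    equal \<open>N\<close> only for points of the space, hence the passage through
    \<open>measurable_cong\<close>.\<close>
  also have "?this \<longleftrightarrow> ?thesis"
  proof (rule measurable_cong)
    fix x assume "x \<in> space \<Omega>"
    then have "f x \<in> carrier_mat N N" "g x \<in> carrier_mat N N"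
      using f g by (auto dest: measurable_space)
    then show "sqrt (\<Sum>i<N. \<Sum>j<N. (cmod (f x $$ (i, j) - g x $$ (i, j)))\<^sup>2) = frob_norm (f x - g x)"
      by (simp add: frob_norm_def)
  qed
  finally show ?thesis .
qed

section \<open>Estimates with a failure symbol and the verdict on them\<close>

lemma sets_option_space:
  "sets (option_space \<Omega>) = {A. A \<subseteq> insert None (Some ` space \<Omega>) \<and> Some -` A \<inter> space \<Omega> \<in> sets \<Omega>}"
proof -
  \<comment> \<open>The generating family is already a sigma-algebra, since preimages under
    \<open>Some\<close> commute with complements and countable unions. Measurability of a set
    therefore depends on its \<open>Some\<close> part alone.\<close>
  have "sigma_algebra (insert None (Some ` space \<Omega>))
      {A. A \<subseteq> insert None (Some ` space \<Omega>) \<and> Some -` A \<inter> space \<Omega> \<in> sets \<Omega>}"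
    unfolding sigma_algebra_iff2
  proof (intro conjI ballI allI impI)
    fix A assume A: "A \<in> {A. A \<subseteq> insert None (Some ` space \<Omega>) \<and> Some -` A \<inter> space \<Omega> \<in> sets \<Omega>}"
    have "Some -` (insert None (Some ` space \<Omega>) - A) \<inter> space \<Omega> = space \<Omega> - (Some -` A \<inter> space \<Omega>)"
      by auto
    then show "insert None (Some ` space \<Omega>) - A \<in>
        {A. A \<subseteq> insert None (Some ` space \<Omega>) \<and> Some -` A \<inter> space \<Omega> \<in> sets \<Omega>}"
      using A by auto
  next
    fix A :: "nat \<Rightarrow> 'a option set"
    assume A: "range A \<subseteq> {A. A \<subseteq> insert None (Some ` space \<Omega>) \<and> Some -` A \<inter> space \<Omega> \<in> sets \<Omega>}"
    then have "(\<Union>i. Some -` A i \<inter> space \<Omega>) \<in> sets \<Omega>"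
      by (intro sets.countable_nat_UN) auto
    also have "(\<Union>i. Some -` A i \<inter> space \<Omega>) = Some -` (\<Union>i. A i) \<inter> space \<Omega>"
      by auto
    finally show "(\<Union>i. A i) \<in> {A. A \<subseteq> insert None (Some ` space \<Omega>) \<and> Some -` A \<inter> space \<Omega> \<in> sets \<Omega>}"
      using A by blast
  qed auto
  then show ?thesis
    unfolding option_space_def by (subst sets_measure_of) (auto simp: sigma_algebra.sigma_sets_eq)
qed

lemma space_option_space: "space (option_space \<Omega>) = insert None (Some ` space \<Omega>)"
  unfolding option_space_def by (subst space_measure_of) auto

lemma measurable_from_option_space:
  assumes f: "(\<lambda>x. f (Some x)) \<in> \<Omega> \<rightarrow>\<^sub>M K" and "f None \<in> space K"
  shows "f \<in> option_space \<Omega> \<rightarrow>\<^sub>M K"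
proof (rule measurableI)
  fix x assume "x \<in> space (option_space \<Omega>)"
  then show "f x \<in> space K" using assms by (auto simp: space_option_space dest: measurable_space)
next
  fix A assume "A \<in> sets K"
  then have "(\<lambda>x. f (Some x)) -` A \<inter> space \<Omega> \<in> sets \<Omega>" using f by (rule measurable_sets [rotated])
  moreover have "Some -` (f -` A \<inter> insert None (Some ` space \<Omega>)) \<inter> space \<Omega> =
      (\<lambda>x. f (Some x)) -` A \<inter> space \<Omega>" by auto
  ultimately show "f -` A \<inter> space (option_space \<Omega>) \<in> sets (option_space \<Omega>)"
    by (simp add: sets_option_space space_option_space)
qed

text \<open>A total version of the matrix entry, so that the two tests of the verifier become real
  functions on all of \<open>option_space\<close>. The default 0 is never decisive:
  \<open>None\<close> is excluded separately whenever validity is tested.\<close>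

definition opt_entry :: "nat \<Rightarrow> nat \<Rightarrow> complex mat option \<Rightarrow> complex" where
  "opt_entry i j m = (case m of None \<Rightarrow> 0 | Some M \<Rightarrow> M $$ (i, j))"

lemma measurable_opt_entry:
  "i < N \<Longrightarrow> j < N \<Longrightarrow> opt_entry i j \<in> borel_measurable (option_space (mat_borel N))"
  by (rule measurable_from_option_space) (simp_all add: opt_entry_def measurable_mat_index)

lemma measurable_is_none: "(\<lambda>m. m = None) \<in> option_space \<Omega> \<rightarrow>\<^sub>M count_space UNIV"
  by (rule measurable_from_option_space) simp_all

lemma verdict_eq_Valid_iff:
  assumes b: "b \<in> carrier_vec N"
    and m: "m \<in> space (option_space (mat_borel N))" "m' \<in> space (option_space (mat_borel N))"
  shows "verdict_of b m m' = Valid \<longleftrightarrow> m \<noteq> None \<and> m' \<noteq> None \<and>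
     Re (\<Sum>i<N. \<Sum>j<N. opt_entry i j m * b $ j * cnj (b $ i)) \<le> 1 / 9 \<and>
     (\<Sum>i<N. \<Sum>j<N. (cmod (opt_entry i j m - opt_entry i j m'))\<^sup>2) \<le> 4 / 729"
proof (cases "m = None \<or> m' = None")
  case True
  then show ?thesis by (cases m; cases m') auto
next
  case False
  then obtain M M' where M: "m = Some M" "m' = Some M'" by auto
  then have car: "M \<in> carrier_mat N N" "M' \<in> carrier_mat N N"
    using m by (auto simp: space_option_space)
  have "Re ((M *\<^sub>v b) \<bullet>c b) = Re (\<Sum>i<N. \<Sum>j<N. M $$ (i, j) * b $ j * cnj (b $ i))"
    using qform_eq [OF car(1) b] b by (simp add: qform_def)
  moreover have "(frob_norm (M - M'))\<^sup>2 = (\<Sum>i<N. \<Sum>j<N. (cmod (M $$ (i, j) - M' $$ (i, j)))\<^sup>2)"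
    using car by (simp add: frob_norm_def sum_nonneg)
  ultimately show ?thesis using M by (simp add: opt_entry_def not_less)
qed

text \<open>Measurability in the pair, rather than in each argument separately, is what makes the
  verdict distribution a measurable kernel in the first estimate, as required for evaluating
  \<open>bind\<close>. It follows because both tests are finite sums of measurable functions of
  entries.\<close>

lemma measurable_verdict_of:
  assumes b: "b \<in> carrier_vec N"
  defines "\<Omega> \<equiv> option_space (mat_borel N)"
  shows "case_prod (verdict_of b) \<in> \<Omega> \<Otimes>\<^sub>M \<Omega> \<rightarrow>\<^sub>M count_space UNIV"
proof -
  have e: "(\<lambda>x. opt_entry i j (fst x)) \<in> borel_measurable (\<Omega> \<Otimes>\<^sub>M \<Omega>)"
    "(\<lambda>x. opt_entry i j (snd x)) \<in> borel_measurable (\<Omega> \<Otimes>\<^sub>M \<Omega>)" if "i < N" "j < N" for i j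
    unfolding \<Omega>_def using measurable_opt_entry [OF that]
    by (auto intro: measurable_compose [OF measurable_fst] measurable_compose [OF measurable_snd])
  have n: "Measurable.pred (\<Omega> \<Otimes>\<^sub>M \<Omega>) (\<lambda>x. fst x = None)" "Measurable.pred (\<Omega> \<Otimes>\<^sub>M \<Omega>) (\<lambda>x. snd x = None)"
    unfolding \<Omega>_def
    by (auto intro: measurable_compose [OF measurable_fst measurable_is_none]
        measurable_compose [OF measurable_snd measurable_is_none])
  have q: "(\<lambda>x. Re (\<Sum>i<N. \<Sum>j<N. opt_entry i j (fst x) * b $ j * cnj (b $ i)))
      \<in> borel_measurable (\<Omega> \<Otimes>\<^sub>M \<Omega>)"
    by (intro measurable_compose [OF _ borel_measurable_Re] borel_measurable_sum borel_measurable_times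
        borel_measurable_const e) simp_all
  have f: "(\<lambda>x. \<Sum>i<N. \<Sum>j<N. (cmod (opt_entry i j (fst x) - opt_entry i j (snd x)))\<^sup>2)
      \<in> borel_measurable (\<Omega> \<Otimes>\<^sub>M \<Omega>)"
    by (intro borel_measurable_sum borel_measurable_power measurable_compose [OF _ borel_measurable_norm]
        borel_measurable_diff e)
      simp_all
  note [measurable] = n q f
  have "Measurable.pred (\<Omega> \<Otimes>\<^sub>M \<Omega>) (\<lambda>x. fst x \<noteq> None \<and> snd x \<noteq> None \<and>
     Re (\<Sum>i<N. \<Sum>j<N. opt_entry i j (fst x) * b $ j * cnj (b $ i)) \<le> 1 / 9 \<and>
     (\<Sum>i<N. \<Sum>j<N. (cmod (opt_entry i j (fst x) - opt_entry i j (snd x)))\<^sup>2) \<le> 4 / 729)"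
    by measurable
  then have "(\<lambda>x. if fst x \<noteq> None \<and> snd x \<noteq> None \<and>
     Re (\<Sum>i<N. \<Sum>j<N. opt_entry i j (fst x) * b $ j * cnj (b $ i)) \<le> 1 / 9 \<and>
     (\<Sum>i<N. \<Sum>j<N. (cmod (opt_entry i j (fst x) - opt_entry i j (snd x)))\<^sup>2) \<le> 4 / 729
     then Valid else Invalid) \<in> \<Omega> \<Otimes>\<^sub>M \<Omega> \<rightarrow>\<^sub>M count_space UNIV"
    by (intro measurable_If measurable_const) (simp_all add: pred_def)
  also have "?this \<longleftrightarrow> case_prod (verdict_of b) \<in> \<Omega> \<Otimes>\<^sub>M \<Omega> \<rightarrow>\<^sub>M count_space UNIV"
  proof (rule measurable_cong)
    fix x assume "x \<in> space (\<Omega> \<Otimes>\<^sub>M \<Omega>)"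
    then have "fst x \<in> space \<Omega>" "snd x \<in> space \<Omega>" by (auto simp: space_pair_measure)
    note iff = verdict_eq_Valid_iff [OF b this [unfolded \<Omega>_def]]
    show "(if fst x \<noteq> None \<and> snd x \<noteq> None \<and>
       Re (\<Sum>i<N. \<Sum>j<N. opt_entry i j (fst x) * b $ j * cnj (b $ i)) \<le> 1 / 9 \<and>
       (\<Sum>i<N. \<Sum>j<N. (cmod (opt_entry i j (fst x) - opt_entry i j (snd x)))\<^sup>2) \<le> 4 / 729
       then Valid else Invalid) = case_prod (verdict_of b) x"
      unfolding iff [symmetric] case_prod_unfold by (cases "verdict_of b (fst x) (snd x)") simp_all
  qed
  finally show ?thesis .
qed

text \<open>A union bound: acceptance requires the first estimate to fall in \<open>R\<close> or the
  second in \<open>R'\<close>. No further property of the two exceptional sets is needed than their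
  measure.\<close>

lemma bind_verdict_Invalid:
  assumes b: "b \<in> carrier_vec N"
    and \<tau>: "prob_space \<tau>" "sets \<tau> = sets (option_space (mat_borel N))"
    and \<tau>': "prob_space \<tau>'" "sets \<tau>' = sets (option_space (mat_borel N))"
    and R: "R \<in> sets \<tau>" "measure \<tau> R \<le> \<delta>" and R': "R' \<in> sets \<tau>'" "measure \<tau>' R' \<le> \<delta>'"
    and invalid: "\<And>m m'. m \<in> space \<tau> - R \<Longrightarrow> m' \<in> space \<tau>' - R' \<Longrightarrow> verdict_of b m m' \<noteq> Valid"
  shows "1 - \<delta> - \<delta>' \<le> measure (\<tau> \<bind> (\<lambda>m. distr \<tau>' (count_space UNIV) (verdict_of b m))) {Invalid}"
proof -
  interpret \<tau>: prob_space \<tau> by fact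
  interpret \<tau>': prob_space \<tau>' by fact
  let ?\<kappa> = "\<lambda>m. distr \<tau>' (count_space UNIV) (verdict_of b m)"
  have joint: "case_prod (verdict_of b) \<in> \<tau> \<Otimes>\<^sub>M \<tau>' \<rightarrow>\<^sub>M count_space UNIV"
    using measurable_verdict_of [OF b]
    unfolding measurable_cong_sets [OF sets_pair_measure_cong [OF \<tau>(2) \<tau>'(2)] refl] .
  have \<kappa>: "?\<kappa> \<in> \<tau> \<rightarrow>\<^sub>M subprob_algebra (count_space UNIV)"
    using joint
    by (rule measurable_distr2) (simp add: space_subprob_algebra \<tau>'.subprob_space_axioms)
  have v: "verdict_of b m \<in> \<tau>' \<rightarrow>\<^sub>M count_space UNIV" if "m \<in> space \<tau>" for m
    using measurable_compose [OF measurable_Pair1' [OF that] joint] by simp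
  interpret bind: prob_space "\<tau> \<bind> ?\<kappa>"
    by (rule \<tau>.prob_space_bind [OF _ \<kappa>]) (auto intro: \<tau>'.prob_space_distr v)
  have sets: "sets (\<tau> \<bind> ?\<kappa>) = UNIV" and space: "space (\<tau> \<bind> ?\<kappa>) = UNIV"
    using sets_bind [of \<tau> ?\<kappa> "count_space UNIV"] space_bind [of \<tau> ?\<kappa> "count_space UNIV"] \<tau>.not_empty
    by simp_all
  have "emeasure (\<tau> \<bind> ?\<kappa>) {Valid} = (\<integral>\<^sup>+ m. emeasure (?\<kappa> m) {Valid} \<partial>\<tau>)"
    using \<tau>.not_empty \<kappa> by (rule emeasure_bind) simp
  \<comment> \<open>Pointwise in \<open>m\<close>: inside \<open>R\<close> the acceptance
    probability is bounded by 1, and outside \<open>R\<close> all accepted second estimates lie in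
    \<open>R'\<close>.\<close>
  also have "\<dots> \<le> (\<integral>\<^sup>+ m. indicator R m + emeasure \<tau>' R' \<partial>\<tau>)"
  proof (rule nn_integral_mono)
    fix m assume m: "m \<in> space \<tau>"
    have e: "emeasure (?\<kappa> m) {Valid} = emeasure \<tau>' (verdict_of b m -` {Valid} \<inter> space \<tau>')"
      using v [OF m] by (simp add: emeasure_distr)
    show "emeasure (?\<kappa> m) {Valid} \<le> indicator R m + emeasure \<tau>' R'"
    proof (cases "m \<in> R")
      case True
      then show ?thesis unfolding e using \<tau>'.emeasure_le_1 by (simp add: add_increasing2)
    next
      case False
      then have "verdict_of b m -` {Valid} \<inter> space \<tau>' \<subseteq> R'" using invalid m by auto
      then show ?thesis unfolding e using False R'(1) by (simp add: emeasure_mono)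
    qed
  qed
  also have "\<dots> = emeasure \<tau> R + emeasure \<tau>' R'"
    using R(1) by (simp add: nn_integral_add \<tau>.emeasure_space_1)
  also have "\<dots> = ennreal (measure \<tau> R + measure \<tau>' R')"
    by (simp add: \<tau>.emeasure_eq_measure \<tau>'.emeasure_eq_measure ennreal_plus)
  finally have "measure (\<tau> \<bind> ?\<kappa>) {Valid} \<le> measure \<tau> R + measure \<tau>' R'"
    by (simp add: bind.emeasure_eq_measure del: ennreal_plus)
  moreover have "UNIV - {Valid} = {Invalid}"
    using verdict.exhaust by auto
  then have "measure (\<tau> \<bind> ?\<kappa>) {Invalid} = 1 - measure (\<tau> \<bind> ?\<kappa>) {Valid}"
    using bind.prob_compl [of "{Valid}"] by (simp add: sets space)
  ultimately show ?thesis using R(2) R'(2) by linarith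
qed

section \<open>Measurement outcomes\<close>

text \<open>\<open>measure_of\<close> falls back to the null measure unless its set function is
  positive and countably additive, so both are proved for the Born rule first. The trace is a finite
  linear combination of the entries of \<open>E B\<close>, so the entrywise additivity of the POVM
  carries over.\<close>

lemma outcome_prob_space:
  assumes E: "povm D \<Omega> E" and \<rho>: "proj_sum D \<rho>" and tr: "mat_trace \<rho> = 1"
  shows "prob_space (outcome \<Omega> E \<rho>)"
proof -
  let ?f = "\<lambda>B. Re (mat_trace (E B * \<rho>))"
  have car: "\<rho> \<in> carrier_mat D D" using \<rho> by (rule proj_sum_carrier)
  have psd: "psd D (E B)" if "B \<in> sets \<Omega>" for B using E that by (auto simp: povm_def)
  have tr_eq: "mat_trace (E B * \<rho>) = (\<Sum>i<D. \<Sum>j<D. E B $$ (i, j) * \<rho> $$ (j, i))" if "B \<in> sets \<Omega>" for B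
  proof -
    have "E B \<in> carrier_mat D D" using psd [OF that] by (simp add: psd_def)
    then show ?thesis using car by (simp add: mat_trace_def index_mult_mat_sum del: index_mult_mat(1))
  qed
  have nonneg: "0 \<le> ?f B" if "B \<in> sets \<Omega>" for B
    using psd [OF that] \<rho> by (rule psd_trace_nonneg)
  have sums: "(\<lambda>m. ?f (B m)) sums ?f (\<Union>m. B m)" if B: "range B \<subseteq> sets \<Omega>" "disjoint_family B" for B
  proof -
    have "(\<lambda>m. \<Sum>i<D. \<Sum>j<D. E (B m) $$ (i, j) * \<rho> $$ (j, i)) sums
        (\<Sum>i<D. \<Sum>j<D. E (\<Union>m. B m) $$ (i, j) * \<rho> $$ (j, i))"
      using E B by (intro sums_sum sums_mult2) (auto simp: povm_def)
    moreover have "(\<Sum>i<D. \<Sum>j<D. E (B m) $$ (i, j) * \<rho> $$ (j, i)) = mat_trace (E (B m) * \<rho>)" for m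
      using B by (intro tr_eq [symmetric]) auto
    moreover have "(\<Sum>i<D. \<Sum>j<D. E (\<Union>m. B m) $$ (i, j) * \<rho> $$ (j, i)) = mat_trace (E (\<Union>m. B m) * \<rho>)"
      using B by (intro tr_eq [symmetric]) auto
    ultimately show ?thesis by (simp add: sums_Re)
  qed
  \<comment> \<open>The empty set repeated is a disjoint family; its constant series converges only
    if the term is 0.\<close>
  have "(\<lambda>m. ?f {}) sums ?f {}"
    using sums [of "\<lambda>_. {}"] by (simp add: disjoint_family_on_def)
  then have "?f {} = 0" by (auto dest!: sums_summable simp: summable_const_iff)
  then have pos: "positive (sets \<Omega>) (\<lambda>B. ennreal (?f B))"
    by (simp add: positive_def)
  have ca: "countably_additive (sets \<Omega>) (\<lambda>B. ennreal (?f B))"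
    unfolding countably_additive_def
  proof (intro allI impI)
    fix B :: "nat \<Rightarrow> 'a set" assume "range B \<subseteq> sets \<Omega>" "disjoint_family B"
    then show "(\<Sum>i. ennreal (?f (B i))) = ennreal (?f (\<Union>i. B i))"
      by (intro suminf_ennreal_eq sums nonneg) auto
  qed
  have "emeasure (outcome \<Omega> E \<rho>) (space \<Omega>) = ennreal (?f (space \<Omega>))"
    unfolding outcome_def using pos ca
    by (intro emeasure_measure_of_sigma) (simp_all add: sets.sigma_algebra_axioms)
  also have "E (space \<Omega>) = 1\<^sub>m D" using E by (simp add: povm_def)
  finally show ?thesis
    using car tr by (intro prob_spaceI) (simp add: outcome_def space_measure_of_conv)
qed

lemma sets_outcome [simp]: "sets (outcome \<Omega> E \<rho>) = sets \<Omega>"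
  by (simp add: outcome_def)

lemma space_outcome [simp]: "space (outcome \<Omega> E \<rho>) = space \<Omega>"
  by (simp add: outcome_def space_measure_of_conv)

section \<open>Amplification by the majority rule\<close>

lemma measurable_agrees_with_majority:
  "Measurable.pred (PiM {..<lam} (\<lambda>_. mat_borel N)) (\<lambda>Ms. agrees_with_majority N s lam Ms i)"
proof (cases "i < lam")
  case True
  let ?P = "PiM {..<lam} (\<lambda>_. mat_borel N)"
  have frob: "(\<lambda>Ms. frob_norm (Ms j - Ms i)) \<in> borel_measurable ?P" if "j < lam" for j
    using that True by (intro measurable_frob_norm_diff [where N = N] measurable_component_singleton) simp_all
  have "Measurable.pred ?P (\<lambda>Ms. (frob_norm (Ms j - Ms i))\<^sup>2 \<le> 4 * real N / real s)" if "j < lam" for j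
    using frob [OF that] by measurable
  then have "(\<lambda>Ms. \<Sum>j<lam. if (frob_norm (Ms j - Ms i))\<^sup>2 \<le> 4 * real N / real s then 1 else (0::real))
      \<in> borel_measurable ?P"
    by (intro borel_measurable_sum measurable_If borel_measurable_const) (simp_all add: pred_def)
  moreover have "agrees_with_majority N s lam Ms i \<longleftrightarrow> real lam / 2 <
      (\<Sum>j<lam. if (frob_norm (Ms j - Ms i))\<^sup>2 \<le> 4 * real N / real s then 1 else (0::real))" for Ms
  proof -
    have "{..<lam} \<inter> {j. (frob_norm (Ms j - Ms i))\<^sup>2 \<le> 4 * real N / real s} =
        {j. j < lam \<and> (frob_norm (Ms j - Ms i))\<^sup>2 \<le> 4 * real N / real s}" by auto
    then show ?thesis using True by (simp add: agrees_with_majority_def sum.If_cases)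
  qed
  ultimately show ?thesis by simp
next
  case False
  then show ?thesis by (simp add: agrees_with_majority_def)
qed

lemma measurable_selected:
  assumes "selection_rule sel"
  shows "(\<lambda>Ms. if \<exists>i. agrees_with_majority N s lam Ms i then Some (Ms (sel N s lam Ms)) else None)
    \<in> PiM {..<lam} (\<lambda>_. mat_borel N) \<rightarrow>\<^sub>M option_space (mat_borel N)" (is "?f \<in> ?P \<rightarrow>\<^sub>M _")
proof (rule measurableI)
  have sel: "sel N s lam \<in> ?P \<rightarrow>\<^sub>M count_space UNIV"
    and agr: "\<And>Ms i. Ms \<in> space ?P \<Longrightarrow> agrees_with_majority N s lam Ms i \<Longrightarrow>
      agrees_with_majority N s lam Ms (sel N s lam Ms)"
    using assms unfolding selection_rule_def by blast+
  {
    fix Ms assume Ms: "Ms \<in> space ?P"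
    show "?f Ms \<in> space (option_space (mat_borel N))"
      using Ms agr [OF Ms] by (auto simp: space_option_space space_PiM agrees_with_majority_def)
  }
  fix A assume "A \<in> sets (option_space (mat_borel N))"
  moreover define S where "S = Some -` A \<inter> carrier_mat N N"
  ultimately have "S \<in> sets (mat_borel N)" by (simp add: sets_option_space)
  then have A: "Measurable.pred ?P (\<lambda>Ms. Ms k \<in> S)" if "k < lam" for k
    using that by (intro pred_sets2 [OF _ measurable_component_singleton]) simp_all
  \<comment> \<open>The selected component has a varying index, so the event is split over the
    finitely many values \<open>k\<close> of the selector; for fixed \<open>k\<close> the component
    is a measurable coordinate. Without an admissible index the result is \<open>None\<close>, and
    the event holds exactly if \<open>None\<close> lies in \<open>A\<close>.\<close>
  have "Measurable.pred ?P (\<lambda>Ms. (\<exists>i\<in>{..<lam}. agrees_with_majority N s lam Ms i) \<and>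
        (\<exists>k\<in>{..<lam}. sel N s lam Ms = k \<and> Ms k \<in> S) \<or>
      \<not> (\<exists>i\<in>{..<lam}. agrees_with_majority N s lam Ms i) \<and> None \<in> A)"
    using sel A by (intro pred_intros_logic pred_intros_finite measurable_agrees_with_majority
        pred_eq_const1 [where N = "count_space UNIV"]) simp_all
  then have "{Ms \<in> space ?P. (\<exists>i\<in>{..<lam}. agrees_with_majority N s lam Ms i) \<and>
        (\<exists>k\<in>{..<lam}. sel N s lam Ms = k \<and> Ms k \<in> S) \<or>
      \<not> (\<exists>i\<in>{..<lam}. agrees_with_majority N s lam Ms i) \<and> None \<in> A} \<in> sets ?P"
    by (simp add: pred_def)
  also have "{Ms \<in> space ?P. (\<exists>i\<in>{..<lam}. agrees_with_majority N s lam Ms i) \<and>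
        (\<exists>k\<in>{..<lam}. sel N s lam Ms = k \<and> Ms k \<in> S) \<or>
      \<not> (\<exists>i\<in>{..<lam}. agrees_with_majority N s lam Ms i) \<and> None \<in> A} = ?f -` A \<inter> space ?P" (is "?L = ?R")
  proof (rule Set.set_eqI)
    fix Ms
    have lt: "i < lam" if "agrees_with_majority N s lam Ms i" for i
      using that by (simp add: agrees_with_majority_def)
    show "Ms \<in> ?L \<longleftrightarrow> Ms \<in> ?R"
    proof (cases "Ms \<in> space ?P \<and> (\<exists>i. agrees_with_majority N s lam Ms i)")
      case True
      then have "sel N s lam Ms < lam" using agr lt by blast
      moreover from this have "Ms (sel N s lam Ms) \<in> carrier_mat N N"
        using True by (auto simp: space_PiM)
      ultimately show ?thesis using True lt by (auto simp: S_def)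
    qed (use lt in auto)
  qed
  finally show "?f -` A \<inter> space ?P \<in> sets ?P" .
qed

text \<open>Exponential Markov inequality, with weight \<open>4\<close> for each inaccurate estimate.\<close>

lemma majority_inaccurate:
  assumes \<mu>: "prob_space \<mu>" and B: "B \<in> sets \<mu>" "measure \<mu> B \<le> 1 / 4"
  shows "{Ms \<in> space (PiM {..<lam} (\<lambda>_. \<mu>)). lam \<le> 2 * card {i. i < lam \<and> Ms i \<in> B}} \<in> sets (PiM {..<lam} (\<lambda>_. \<mu>))"
    and "measure (PiM {..<lam} (\<lambda>_. \<mu>)) {Ms \<in> space (PiM {..<lam} (\<lambda>_. \<mu>)). lam \<le> 2 * card {i. i < lam \<and> Ms i \<in> B}}
      \<le> (7 / 8) ^ lam"
proof -
  interpret \<mu>: prob_space \<mu> by fact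
  let ?P = "PiM {..<lam} (\<lambda>_. \<mu>)"
  let ?A = "{Ms \<in> space ?P. lam \<le> 2 * card {i. i < lam \<and> Ms i \<in> B}}"
  interpret P: prob_space ?P by (intro prob_space_PiM \<mu>)
  interpret prod: product_sigma_finite "\<lambda>_. \<mu>" by standard
  have card: "real (card {i. i < lam \<and> Ms i \<in> B}) = (\<Sum>i<lam. indicator B (Ms i))" for Ms :: "nat \<Rightarrow> 'a"
  proof -
    have "{..<lam} \<inter> {i. Ms i \<in> B} = {i. i < lam \<and> Ms i \<in> B}" by auto
    then show ?thesis by (simp add: indicator_def sum.If_cases)
  qed
  have "(\<lambda>Ms. \<Sum>i<lam. indicator B (Ms i) :: real) \<in> borel_measurable ?P"
    using B by (intro borel_measurable_sum measurable_compose [OF measurable_component_singleton]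
        borel_measurable_indicator) simp_all
  then have "{Ms \<in> space ?P. real lam \<le> 2 * (\<Sum>i<lam. indicator B (Ms i))} \<in> sets ?P"
    by measurable
  also have "(\<lambda>Ms. real lam \<le> 2 * (\<Sum>i<lam. indicator B (Ms i))) =
      (\<lambda>Ms. lam \<le> 2 * card {i. i < lam \<and> Ms i \<in> B})"
    unfolding card [symmetric] by (rule ext) linarith
  finally show A: "?A \<in> sets ?P" .
  \<comment> \<open>The weight is 4 on \<open>B\<close> and 1 elsewhere. Since 4 = 2^2, having at
    least half of the components in \<open>B\<close> makes the product at least 2^lam.\<close>
  let ?h = "\<lambda>x. 1 + 3 * indicator B x :: ennreal"
  have h: "?h \<in> borel_measurable \<mu>" using B by simp
  have "2 ^ lam * emeasure ?P ?A = (\<integral>\<^sup>+ Ms. 2 ^ lam * indicator ?A Ms \<partial>?P)"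
    by (rule nn_integral_cmult_indicator [OF A, symmetric])
  also have "\<dots> \<le> (\<integral>\<^sup>+ Ms. (\<Prod>i<lam. ?h (Ms i)) \<partial>?P)"
  proof (rule nn_integral_mono)
    fix Ms assume "Ms \<in> space ?P"
    have "{..<lam} \<inter> {i. Ms i \<in> B} = {i. i < lam \<and> Ms i \<in> B}" by auto
    moreover have "(\<Prod>i<lam. ?h (Ms i)) = (\<Prod>i<lam. if Ms i \<in> B then 4 else 1)"
      by (intro prod.cong) (auto simp: indicator_def)
    ultimately have prod: "(\<Prod>i<lam. ?h (Ms i)) = 4 ^ card {i. i < lam \<and> Ms i \<in> B}"
      by (simp add: prod.If_cases)
    have "(2 :: ennreal) ^ lam \<le> 4 ^ card {i. i < lam \<and> Ms i \<in> B}" if "Ms \<in> ?A"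
    proof -
      have "(2 :: ennreal) ^ lam \<le> 2 ^ (2 * card {i. i < lam \<and> Ms i \<in> B})"
        using that by (intro power_increasing) simp_all
      then show ?thesis by (simp add: power_mult)
    qed
    then show "2 ^ lam * indicator ?A Ms \<le> (\<Prod>i<lam. ?h (Ms i))"
      unfolding prod by (cases "Ms \<in> ?A") simp_all
  qed
  also have "\<dots> = (\<Prod>i<lam. \<integral>\<^sup>+ x. ?h x \<partial>\<mu>)"
    using h by (intro prod.product_nn_integral_prod) simp_all
  also have "(\<integral>\<^sup>+ x. ?h x \<partial>\<mu>) = 1 + 3 * emeasure \<mu> B"
    using B(1) by (simp add: nn_integral_add nn_integral_cmult \<mu>.emeasure_space_1)
  also have "\<dots> = ennreal (1 + 3 * measure \<mu> B)"
    by (simp add: \<mu>.emeasure_eq_measure ennreal_plus ennreal_mult flip: ennreal_1 ennreal_numeral)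
  also have "(\<Prod>i<lam. ennreal (1 + 3 * measure \<mu> B)) = ennreal ((1 + 3 * measure \<mu> B) ^ lam)"
    by (simp add: ennreal_power del: ennreal_plus)
  finally have "ennreal (2 ^ lam * measure ?P ?A) \<le> ennreal ((1 + 3 * measure \<mu> B) ^ lam)"
    by (simp add: P.emeasure_eq_measure ennreal_mult flip: ennreal_numeral ennreal_power)
  then have "2 ^ lam * measure ?P ?A \<le> (1 + 3 * measure \<mu> B) ^ lam"
    by (simp add: ennreal_le_iff)
  \<comment> \<open>Each factor has mean at most 1 + 3/4; division by 2^lam leaves 7/8 as the
    base.\<close>
  also have "\<dots> \<le> (7 / 4) ^ lam"
    using B(2) by (intro power_mono) simp_all
  also have "\<dots> = 2 ^ lam * (7 / 8 :: real) ^ lam"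
    by (simp flip: power_mult_distrib)
  finally show "measure ?P ?A \<le> (7 / 8) ^ lam"
    by simp
qed

text \<open>More than half of the estimates are close to the selected one and fewer than half are
  inaccurate, so some accurate \<open>Ms j\<close> is close to it. The triangle inequality through
  \<open>Ms j\<close> adds 2 sqrt(N/s) and sqrt(N/s).\<close>

lemma selected_accurate:
  assumes sel: "selection_rule sel" and Ms: "Ms \<in> space (PiM {..<lam} (\<lambda>_. mat_borel N))"
    and \<rho>: "\<rho> \<in> carrier_mat N N"
    and agr: "agrees_with_majority N s lam Ms i"
    and few: "2 * card {j. j < lam \<and> real N / real s < (frob_norm (Ms j - \<rho>))\<^sup>2} < lam"
  shows "frob_norm (Ms (sel N s lam Ms) - \<rho>) \<le> 3 * sqrt (real N / real s)"
proof -
  let ?i = "sel N s lam Ms"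
  let ?G = "{j. j < lam \<and> (frob_norm (Ms j - Ms ?i))\<^sup>2 \<le> 4 * real N / real s}"
  let ?B = "{j. j < lam \<and> real N / real s < (frob_norm (Ms j - \<rho>))\<^sup>2}"
  have "agrees_with_majority N s lam Ms ?i"
    using sel Ms agr unfolding selection_rule_def by blast
  then have i: "?i < lam" and G: "real lam / 2 < real (card ?G)" by (simp_all add: agrees_with_majority_def)
  have "\<not> ?G \<subseteq> ?B"
    using card_mono [of ?B ?G] G few by fastforce
  then obtain j where j: "j < lam" "(frob_norm (Ms j - Ms ?i))\<^sup>2 \<le> 4 * real N / real s"
    "(frob_norm (Ms j - \<rho>))\<^sup>2 \<le> real N / real s" by force
  have car: "Ms ?i \<in> carrier_mat N N" "Ms j \<in> carrier_mat N N"
    using Ms i j(1) by (auto simp: space_PiM)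
  have "frob_norm (Ms j - Ms ?i) \<le> sqrt (4 * (real N / real s))"
    using j(2) by (intro real_le_rsqrt) simp
  moreover have "sqrt (4 * (real N / real s)) = 2 * sqrt (real N / real s)"
    by (simp only: real_sqrt_mult real_sqrt_four)
  moreover have "frob_norm (Ms j - \<rho>) \<le> sqrt (real N / real s)"
    using j(3) by (rule real_le_rsqrt)
  ultimately show ?thesis
    using frob_norm_triangle [OF car(1) car(2) \<rho>] frob_norm_minus_commute [OF car] by simp
qed

lemma block_replicate: "i < k \<Longrightarrow> block m i (replicate (m * k) x) = replicate m x"
proof -
  assume "i < k"
  then have "m * Suc i \<le> m * k" by (intro mult_le_mono2) simp
  then have "m \<le> m * k - i * m" by (simp add: mult.commute)
  then show ?thesis by (simp add: block_def min_absorb1)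
qed

text \<open>The exceptional set \<open>R\<close> contains only returned matrices: a failure symbol
  is not counted as an error, because the verifier rejects it anyway. No lower bound on the
  probability of success is therefore required.\<close>

lemma tomography_imp_accurate:
  fixes \<rho> :: "complex mat" and lam :: nat
  assumes T: "tomography_procedure T" and sel: "selection_rule sel" and Ns: "1 \<le> N" "1 \<le> s"
    and \<rho>: "proj_sum N \<rho>" "mat_trace \<rho> = 1"
  defines "\<tau> \<equiv> tomography_imp T sel N s lam (replicate (4 * s * N\<^sup>2 * lam) \<rho>)"
    and "R \<equiv> {m \<in> space (option_space (mat_borel N)).
      \<exists>M. m = Some M \<and> 3 * sqrt (real N / real s) < frob_norm (M - \<rho>)}"
  shows "prob_space \<tau>" "sets \<tau> = sets (option_space (mat_borel N))" "R \<in> sets \<tau>"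
    "measure \<tau> R \<le> (7 / 8) ^ lam"
proof -
  define \<mu> where "\<mu> = outcome (mat_borel N) (T N (4 * s)) (tensor_power \<rho> (4 * s * N\<^sup>2))"
  let ?P = "PiM {..<lam} (\<lambda>_. \<mu>)"
  let ?Q = "PiM {..<lam} (\<lambda>_. mat_borel N)"
  let ?f = "\<lambda>Ms. if \<exists>i. agrees_with_majority N s lam Ms i then Some (Ms (sel N s lam Ms)) else None"
  have car: "\<rho> \<in> carrier_mat N N" using \<rho>(1) by (rule proj_sum_carrier)
  have Ns': "1 \<le> 4 * s" using Ns by simp
  have povm: "povm (N ^ (4 * s * N\<^sup>2)) (mat_borel N) (T N (4 * s))"
    using T Ns(1) Ns' unfolding tomography_procedure_def by blast
  have sets_\<mu>: "sets \<mu> = sets (mat_borel N)" and space_\<mu>: "space \<mu> = carrier_mat N N"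
    by (simp_all add: \<mu>_def)
  have \<mu>: "prob_space \<mu>"
    unfolding \<mu>_def
    by (intro outcome_prob_space [OF povm] proj_sum_tensor_power \<rho>(1))
      (simp add: mat_trace_tensor_power [OF car] \<rho>(2))
  interpret \<mu>: prob_space \<mu> by (rule \<mu>)
  have "density N \<rho>" using \<rho> by (simp add: density_def proj_sum_psd)
  then have err: "(\<integral>\<^sup>+ M. ennreal ((frob_norm (M - \<rho>))\<^sup>2) \<partial>\<mu>) \<le> ennreal (real N / real (4 * s))"
    unfolding \<mu>_def using T Ns(1) Ns' unfolding tomography_procedure_def by blast
  have frob: "(\<lambda>M. frob_norm (M - \<rho>)) \<in> borel_measurable (mat_borel N)"
    using car by (intro measurable_frob_norm_diff [where N = N]) simp_all
  then have frob_\<mu>: "(\<lambda>M. frob_norm (M - \<rho>)) \<in> borel_measurable \<mu>"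
    by (simp cong: measurable_cong_sets add: sets_\<mu>)
  let ?B = "{M \<in> space \<mu>. real N / real s < (frob_norm (M - \<rho>))\<^sup>2}"
  have B: "?B \<in> sets \<mu>" using frob_\<mu> by measurable
  \<comment> \<open>Markov's inequality at level N/s. The inner procedure runs with parameter
    \<open>4 * s\<close>, so its mean squared error N/(4s) is a quarter of that level.\<close>
  have "ennreal (real N / real s) * emeasure \<mu> ?B = (\<integral>\<^sup>+ M. ennreal (real N / real s) * indicator ?B M \<partial>\<mu>)"
    by (rule nn_integral_cmult_indicator [OF B, symmetric])
  also have "\<dots> \<le> (\<integral>\<^sup>+ M. ennreal ((frob_norm (M - \<rho>))\<^sup>2) \<partial>\<mu>)"
    by (intro nn_integral_mono) (auto simp: indicator_def intro!: ennreal_leI)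
  also note err
  finally have "real N / real s * measure \<mu> ?B \<le> real N / real s * (1 / 4)"
    by (simp add: \<mu>.emeasure_eq_measure ennreal_le_iff flip: ennreal_mult)
  then have B4: "measure \<mu> ?B \<le> 1 / 4" using Ns by (simp add: field_simps)
  interpret P: prob_space ?P by (intro prob_space_PiM \<mu>)
  \<comment> \<open>All blocks of a replicated supply coincide, so the estimates are independent
    with the common law \<mu>.\<close>
  have \<tau>_eq: "\<tau> = distr ?P (option_space (mat_borel N)) ?f"
    unfolding \<tau>_def tomography_imp_def \<mu>_def
    by (intro arg_cong [where f = "\<lambda>M. distr M _ _"] PiM_cong refl)
      (simp add: block_replicate tensor_power_def)
  have sets_P: "sets ?P = sets ?Q" by (intro sets_PiM_cong refl sets_\<mu>)
  have f: "?f \<in> ?P \<rightarrow>\<^sub>M option_space (mat_borel N)"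
    using measurable_selected [OF sel] unfolding measurable_cong_sets [OF sets_P refl] .
  show "prob_space \<tau>" unfolding \<tau>_eq by (rule P.prob_space_distr [OF f])
  show sets_\<tau>: "sets \<tau> = sets (option_space (mat_borel N))" by (simp add: \<tau>_eq)
  have "Some -` R \<inter> carrier_mat N N = {M \<in> space (mat_borel N). 3 * sqrt (real N / real s) < frob_norm (M - \<rho>)}"
    by (auto simp: R_def space_option_space)
  also have "\<dots> \<in> sets (mat_borel N)" using frob by measurable
  finally show R: "R \<in> sets \<tau>" unfolding sets_\<tau> sets_option_space by (auto simp: R_def space_option_space)
  let ?A = "{Ms \<in> space ?P. lam \<le> 2 * card {i. i < lam \<and> Ms i \<in> ?B}}"
  have "?f -` R \<inter> space ?P \<subseteq> ?A"
  proof
    fix Ms assume "Ms \<in> ?f -` R \<inter> space ?P"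
    then have Ms: "Ms \<in> space ?P" and fR: "?f Ms \<in> R" by auto
    from fR obtain i where agr: "agrees_with_majority N s lam Ms i"
      and far: "3 * sqrt (real N / real s) < frob_norm (Ms (sel N s lam Ms) - \<rho>)"
      by (auto simp: R_def split: if_splits)
    have "Ms \<in> space ?Q" using Ms sets_eq_imp_space_eq [OF sets_P] by simp
    from selected_accurate [OF sel this car agr] far
    have "lam \<le> 2 * card {j. j < lam \<and> real N / real s < (frob_norm (Ms j - \<rho>))\<^sup>2}" by linarith
    also have "{j. j < lam \<and> real N / real s < (frob_norm (Ms j - \<rho>))\<^sup>2} = {i. i < lam \<and> Ms i \<in> ?B}"
      using Ms by (auto simp: space_PiM)
    finally show "Ms \<in> ?A" using Ms by simp
  qed
  then have "measure ?P (?f -` R \<inter> space ?P) \<le> measure ?P ?A"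
    by (rule P.finite_measure_mono) (rule majority_inaccurate(1) [OF \<mu> B B4])
  also have "\<dots> \<le> (7 / 8) ^ lam" by (rule majority_inaccurate(2) [OF \<mu> B B4])
  finally show "measure \<tau> R \<le> (7 / 8) ^ lam"
    unfolding \<tau>_eq using R by (subst measure_distr [OF f]) (simp_all add: \<tau>_eq)
qed

section \<open>States with recognizable abort\<close>

text \<open>The common shape of the output of \<open>Ghat\<close> and of its Pauli conjugate; in the
  latter the abort vector \<open>w\<close> is rotated as well.\<close>

definition two_mix :: "real \<Rightarrow> complex Matrix.vec \<Rightarrow> complex Matrix.vec \<Rightarrow> complex mat" where
  "two_mix \<eta> v w = complex_of_real \<eta> \<cdot>\<^sub>m proj v + complex_of_real (1 - \<eta>) \<cdot>\<^sub>m proj w"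

lemma two_mix_carrier: "v \<in> carrier_vec N \<Longrightarrow> w \<in> carrier_vec N \<Longrightarrow> two_mix \<eta> v w \<in> carrier_mat N N"
  by (auto simp: two_mix_def)

lemma proj_sum_two_mix:
  "0 \<le> \<eta> \<Longrightarrow> \<eta> \<le> 1 \<Longrightarrow> v \<in> carrier_vec N \<Longrightarrow> w \<in> carrier_vec N \<Longrightarrow> proj_sum N (two_mix \<eta> v w)"
  unfolding two_mix_def by (intro proj_sum_add proj_sum_smult) simp_all

lemma mat_trace_two_mix:
  assumes "pure_state N v" "pure_state N w"
  shows "mat_trace (two_mix \<eta> v w) = 1"
proof -
  note v = pure_stateD [OF assms(1)] and w = pure_stateD [OF assms(2)]
  have "proj v \<in> carrier_mat N N" "proj w \<in> carrier_mat N N" using v(1) w(1) by auto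
  then show ?thesis
    unfolding two_mix_def by (simp add: mat_trace_add [where n = N] mat_trace_smult [where n = N]
        mat_trace_proj v(3) w(3))
qed

lemma qform_two_mix:
  assumes "v \<in> carrier_vec N" "w \<in> carrier_vec N" "u \<in> carrier_vec N"
  shows "qform (two_mix \<eta> v w) u = \<eta> * (cmod (v \<bullet>c u))\<^sup>2 + (1 - \<eta>) * (cmod (w \<bullet>c u))\<^sup>2"
proof -
  have p: "proj v \<in> carrier_mat N N" "proj w \<in> carrier_mat N N" using assms by auto
  then have "qform (two_mix \<eta> v w) u =
      qform (complex_of_real \<eta> \<cdot>\<^sub>m proj v) u + qform (complex_of_real (1 - \<eta>) \<cdot>\<^sub>m proj w) u"
    unfolding two_mix_def using assms by (intro qform_add [where n = N]) simp_all
  also have "\<dots> = \<eta> * qform (proj v) u + (1 - \<eta>) * qform (proj w) u"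
    using p assms by (simp only: qform_smult)
  finally show ?thesis using assms by (simp add: qform_proj)
qed

lemma conj_two_mix:
  assumes V: "V \<in> carrier_mat N N" and h: "\<And>i j. i < N \<Longrightarrow> j < N \<Longrightarrow> V $$ (j, i) = cnj (V $$ (i, j))"
    and vw: "v \<in> carrier_vec N" "w \<in> carrier_vec N"
  shows "V * two_mix \<eta> v w * V = two_mix \<eta> (V *\<^sub>v v) (V *\<^sub>v w)"
proof -
  have p: "proj v \<in> carrier_mat N N" "proj w \<in> carrier_mat N N" using vw by auto
  let ?A = "complex_of_real \<eta> \<cdot>\<^sub>m proj v" and ?B = "complex_of_real (1 - \<eta>) \<cdot>\<^sub>m proj w"
  have AB: "?A \<in> carrier_mat N N" "?B \<in> carrier_mat N N" using p by simp_all
  have "V * (?A + ?B) * V = V * ?A * V + V * ?B * V"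
    by (simp only: mult_add_distrib_mat [OF V AB]
        add_mult_distrib_mat [OF mult_carrier_mat [OF V AB(1)] mult_carrier_mat [OF V AB(2)] V])
  also have "V * ?A * V = complex_of_real \<eta> \<cdot>\<^sub>m (V * proj v * V)"
    using V p(1) by (simp add: mult_smult_distrib [OF V p(1)] mult_smult_assoc_mat [where nr = N and n = N and nc = N])
  also have "V * ?B * V = complex_of_real (1 - \<eta>) \<cdot>\<^sub>m (V * proj w * V)"
    using V p(2) by (simp add: mult_smult_distrib [OF V p(2)] mult_smult_assoc_mat [where nr = N and n = N and nc = N])
  finally show ?thesis
    unfolding two_mix_def by (simp only: hermitian_conj_proj [OF V h vw(1)] hermitian_conj_proj [OF V h vw(2)])
qed

lemma bit_ket_carrier [simp]: "bit_ket b \<in> carrier_vec 2"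
  by (simp add: bit_ket_def)

lemma bit_ket_cscalar_prod: "bit_ket a \<bullet>c bit_ket b = of_bool (a = b)"
  by (cases a; cases b) (simp_all add: bit_ket_def cscalar_prod_sum numeral_2_eq_2)

lemma pure_state_kron_bit_ket:
  assumes "pure_state (2 ^ n) \<psi>"
  shows "pure_state (2 ^ (n + 1)) (kron_vec (bit_ket b) \<psi>)"
  using assms kron_vec_carrier [of "bit_ket b" 2 \<psi> "2 ^ n"]
  by (simp add: pure_state_def kron_vec_cscalar_prod bit_ket_cscalar_prod)

lemma kron_bit_ket_cscalar_prod:
  "dim_vec v = dim_vec w \<Longrightarrow> kron_vec (bit_ket a) v \<bullet>c kron_vec (bit_ket b) w = of_bool (a = b) * (v \<bullet>c w)"
  by (simp add: kron_vec_cscalar_prod bit_ket_cscalar_prod bit_ket_def)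

text \<open>A Pauli is Hermitian and squares to the identity: one factor moves across the scalar
  product and cancels the other.\<close>

lemma pure_state_pauli:
  assumes "pure_state (2 ^ length P) \<psi>"
  shows "pure_state (2 ^ length P) (pauli_mat P *\<^sub>v \<psi>)"
proof -
  let ?P = "pauli_mat P"
  note \<psi> = pure_stateD [OF assms]
  have P\<psi>: "?P *\<^sub>v \<psi> \<in> carrier_vec (2 ^ length P)"
    using \<psi>(1) pauli_mat_carrier by (rule mult_mat_vec_carrier [rotated])
  have "?P *\<^sub>v (?P *\<^sub>v \<psi>) = \<psi>"
    using assoc_mult_mat_vec [OF pauli_mat_carrier pauli_mat_carrier \<psi>(1)] \<psi>(1)
    by (simp add: pauli_mat_square)
  then have "(?P *\<^sub>v \<psi>) \<bullet>c (?P *\<^sub>v \<psi>) = \<psi> \<bullet>c \<psi>"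
    using cscalar_prod_hermitian [OF pauli_mat_carrier pauli_mat_hermitian P\<psi> \<psi>(1)] by simp
  then show ?thesis using P\<psi> \<psi>(3) by (simp add: pure_state_def)
qed

lemma pauli_mat_PI_Cons_mult_kron_bit_ket:
  "dim_vec \<psi> = 2 ^ length P \<Longrightarrow>
   pauli_mat (PI # P) *\<^sub>v kron_vec (bit_ket b) \<psi> = kron_vec (bit_ket b) (pauli_mat P *\<^sub>v \<psi>)"
  by (simp add: pauli_mat_Cons kron_mult_vec bit_ket_def)

lemma Phi_False:
  assumes "gen_out Ghat lam k x \<in> carrier_mat (2 ^ (length P + 1)) (2 ^ (length P + 1))"
  shows "Phi Ghat lam (P, k, x, False) = gen_out Ghat lam k x"
  using assms by (simp add: kron_one)

text \<open>The identity on the flag qubit tensored with \<open>P\<close> is the Pauli string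
  \<open>PI # P\<close>, so hermiticity of Pauli strings applies to the whole conjugating operator
  while the flag stays fixed.\<close>

lemma Phi_True:
  assumes gen: "gen_out Ghat lam k x = two_mix \<eta> (kron_vec (bit_ket False) \<psi>) (kron_vec (bit_ket True) \<beta>)"
    and \<psi>: "\<psi> \<in> carrier_vec (2 ^ length P)" and \<beta>: "\<beta> \<in> carrier_vec (2 ^ length P)"
  shows "Phi Ghat lam (P, k, x, True) =
    two_mix \<eta> (kron_vec (bit_ket False) (pauli_mat P *\<^sub>v \<psi>)) (kron_vec (bit_ket True) (pauli_mat P *\<^sub>v \<beta>))"
proof -
  let ?V = "pauli_mat (PI # P)"
  have "Phi Ghat lam (P, k, x, True) = ?V * gen_out Ghat lam k x * ?V"
    using left_mult_one_mat [OF pauli_mat_carrier, of P] by (simp add: pauli_mat_Cons Let_def)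
  also have "\<dots> = two_mix \<eta> (?V *\<^sub>v kron_vec (bit_ket False) \<psi>) (?V *\<^sub>v kron_vec (bit_ket True) \<beta>)"
    unfolding gen
    using kron_vec_carrier [OF bit_ket_carrier \<psi>] kron_vec_carrier [OF bit_ket_carrier \<beta>]
    by (intro conj_two_mix [OF pauli_mat_carrier pauli_mat_hermitian]) simp_all
  finally show ?thesis using \<psi> \<beta> by (simp add: pauli_mat_PI_Cons_mult_kron_bit_ket)
qed

section \<open>The probability of rejection\<close>

text \<open>Matches the stated number of copies with the consumption 4 s N^2 lam of the amplified
  procedure, for N = 2^(n+1) and s = 3^8 N.\<close>

lemma num_copies_eq:
  "num_copies lam = 4 * (3 ^ 8 * 2 ^ (output_len lam + 1)) * (2 ^ (output_len lam + 1))\<^sup>2 * lam"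
proof -
  have pow: "(2 :: nat) ^ (3 * m + 2) = (2 ^ m) ^ 3 * 4" for m
    by (simp add: power_add mult.commute flip: power_mult)
  show ?thesis unfolding num_copies_def pow by (simp only: power2_eq_square power3_eq_cube mult_ac)
qed

lemma Tomography_accurate:
  assumes T: "tomography_procedure T" and sel: "selection_rule sel"
    and \<rho>: "proj_sum (2 ^ (output_len lam + 1)) \<rho>" "mat_trace \<rho> = 1"
  defines "\<tau> \<equiv> Tomography T sel lam (replicate (num_copies lam) \<rho>)"
  obtains R where "prob_space \<tau>" "sets \<tau> = sets (option_space (mat_borel (2 ^ (output_len lam + 1))))"
    "R \<in> sets \<tau>" "measure \<tau> R \<le> (7 / 8) ^ lam" "\<And>M. Some M \<in> space \<tau> - R \<Longrightarrow>
      M \<in> carrier_mat (2 ^ (output_len lam + 1)) (2 ^ (output_len lam + 1)) \<and> frob_norm (M - \<rho>) \<le> 1 / 27"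
proof -
  let ?N = "2 ^ (output_len lam + 1) :: nat"
  let ?s = "3 ^ 8 * 2 ^ (output_len lam + 1) :: nat"
  \<comment> \<open>The factor 3^8 in \<open>?s\<close> gives N/s = 3^-8, so the threshold 3
    sqrt(N/s) equals 3/81 = 1/27.\<close>
  have "real ?N / real ?s = (1 / 81)\<^sup>2" by (simp add: power2_eq_square)
  then have "3 * sqrt (real ?N / real ?s) = 1 / 27" by (simp only: real_sqrt_abs)
  note acc = tomography_imp_accurate [OF T sel _ _ \<rho>, of ?s lam, folded num_copies_eq Tomography_def,
      folded \<tau>_def, unfolded this]
  show ?thesis
  proof (rule that [OF acc])
    fix M
    let ?R = "{m \<in> space (option_space (mat_borel ?N)). \<exists>M. m = Some M \<and> 1 / 27 < frob_norm (M - \<rho>)}"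
    assume "Some M \<in> space \<tau> - ?R"
    moreover have "space \<tau> = space (option_space (mat_borel ?N))"
      using acc(2) by (intro sets_eq_imp_space_eq) simp_all
    ultimately show "M \<in> carrier_mat ?N ?N \<and> frob_norm (M - \<rho>) \<le> 1 / 27"
      by (auto simp: space_option_space)
  qed simp_all
qed

text \<open>Two tomography runs contribute one (7/8)^lam each. The overlap enters linearly, so that
  averaging over \<open>P\<close> later needs only its mean.\<close>

lemma Verify_Invalid:
  assumes T: "tomography_procedure T" and sel: "selection_rule sel"
    and n: "n = output_len lam" and P: "P \<in> paulis n"
    and \<beta>: "pure_state (2 ^ n) (bothat lam)"
    and \<psi>0: "0 \<le> \<eta>0" "\<eta>0 \<le> 1" "pure_state (2 ^ n) \<psi>0"
      "gen_out Ghat lam k0 x = two_mix \<eta>0 (kron_vec (bit_ket False) \<psi>0) (abort_state (bothat lam))"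
    and \<psi>1: "0 \<le> \<eta>1" "\<eta>1 \<le> 1" "pure_state (2 ^ n) \<psi>1"
      "gen_out Ghat lam k1 x = two_mix \<eta>1 (kron_vec (bit_ket False) \<psi>1) (abort_state (bothat lam))"
  shows "1 - 2 * (7 / 8) ^ lam - 2 * (cmod ((pauli_mat P *\<^sub>v \<psi>1) \<bullet>c \<psi>0))\<^sup>2 \<le>
    measure (Tomography T sel lam (replicate (num_copies lam) (Phi Ghat lam (P, k0, x, False)))
      \<bind> Verify T sel Ghat bothat lam (P, k1, x, True)) {Invalid}"
proof (cases "(cmod ((pauli_mat P *\<^sub>v \<psi>1) \<bullet>c \<psi>0))\<^sup>2 < 19 / 27")
  case False
  \<comment> \<open>Twice the overlap is at least 38/27 here, which exceeds 1.\<close>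
  have "1 - 2 * (7 / 8) ^ lam - 2 * (cmod ((pauli_mat P *\<^sub>v \<psi>1) \<bullet>c \<psi>0))\<^sup>2 \<le> 0"
    using False zero_le_power [of "7 / 8 :: real" lam] by linarith
  then show ?thesis by (rule order_trans) simp
next
  case True
  let ?N = "2 ^ (n + 1) :: nat"
  have len: "length P = n" using P by (simp add: paulis_def)
  define \<beta>' where "\<beta>' = bothat lam"
  define u where "u = kron_vec (bit_ket False) \<psi>0"
  define b where "b = kron_vec (bit_ket True) \<beta>'"
  define v where "v = kron_vec (bit_ket False) (pauli_mat P *\<^sub>v \<psi>1)"
  define w where "w = kron_vec (bit_ket True) (pauli_mat P *\<^sub>v \<beta>')"
  have \<beta>': "pure_state (2 ^ n) \<beta>'" using \<beta> by (simp add: \<beta>'_def)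
  have b: "abort_state (bothat lam) = b" by (simp add: abort_state_def b_def \<beta>'_def)
  have pure: "pure_state ?N u" "pure_state ?N b" "pure_state ?N v" "pure_state ?N w"
    unfolding u_def b_def v_def w_def using \<psi>0(3) \<psi>1(3) \<beta>' pure_state_pauli [of P] len
    by (simp_all only: pure_state_kron_bit_ket)
  note car = pure(1,2,3,4) [THEN pure_stateD(1)]
  define \<rho> where "\<rho> = Phi Ghat lam (P, k0, x, False)"
  define \<sigma> where "\<sigma> = Phi Ghat lam (P, k1, x, True)"
  have gen0: "gen_out Ghat lam k0 x = two_mix \<eta>0 u b" using \<psi>0(4) by (simp add: u_def b)
  have \<rho>: "\<rho> = two_mix \<eta>0 u b"
    using Phi_False [of Ghat lam k0 x P] two_mix_carrier [OF car(1,2)] len by (simp only: \<rho>_def gen0)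
  have \<sigma>: "\<sigma> = two_mix \<eta>1 v w"
    unfolding \<sigma>_def v_def w_def
    using \<psi>1(4) pure_stateD(1) [OF \<psi>1(3)] pure_stateD(1) [OF \<beta>'] len
    by (intro Phi_True) (simp_all add: b b_def)
  have dims: "dim_vec \<psi>0 = 2 ^ n" "dim_vec \<psi>1 = 2 ^ n" "dim_vec \<beta>' = 2 ^ n"
    "dim_vec (pauli_mat P *\<^sub>v \<psi>1) = 2 ^ n" "dim_vec (pauli_mat P *\<^sub>v \<beta>') = 2 ^ n"
    using pure_stateD(2) [OF \<psi>0(3)] pure_stateD(2) [OF \<psi>1(3)] pure_stateD(2) [OF \<beta>'] len by simp_all
  \<comment> \<open>Vectors with different flag bits are orthogonal. In particular the rotated abort
    vector \<open>w\<close> is invisible in the state \<open>u\<close>, and only the Pauli overlap,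
    scaled by \<open>\<eta>1\<close>, remains of \<sigma>.\<close>
  have ip: "u \<bullet>c u = 1" "b \<bullet>c b = 1" "u \<bullet>c b = 0" "b \<bullet>c u = 0" "w \<bullet>c u = 0"
    "v \<bullet>c u = (pauli_mat P *\<^sub>v \<psi>1) \<bullet>c \<psi>0"
    using pure(1,2) [THEN pure_stateD(3)]
    unfolding u_def b_def v_def w_def by (simp_all add: kron_bit_ket_cscalar_prod dims len)
  have q\<rho>: "qform \<rho> u = \<eta>0" "qform \<rho> b = 1 - \<eta>0"
    unfolding \<rho> by (simp_all add: qform_two_mix [OF car(1,2) car(1)] qform_two_mix [OF car(1,2) car(2)] ip)
  have "qform \<sigma> u = \<eta>1 * (cmod ((pauli_mat P *\<^sub>v \<psi>1) \<bullet>c \<psi>0))\<^sup>2"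
    unfolding \<sigma> by (simp add: qform_two_mix [OF car(3,4) car(1)] ip)
  also have "\<dots> \<le> (cmod ((pauli_mat P *\<^sub>v \<psi>1) \<bullet>c \<psi>0))\<^sup>2"
    using \<psi>1(1,2) by (intro mult_left_le_one_le) simp_all
  finally have q\<sigma>: "qform \<sigma> u < 19 / 27" using True by linarith
  have ps: "proj_sum ?N \<rho>" "proj_sum ?N \<sigma>" and tr: "mat_trace \<rho> = 1" "mat_trace \<sigma> = 1"
    unfolding \<rho> \<sigma> using \<psi>0(1,2) \<psi>1(1,2) car pure
    by (auto intro: proj_sum_two_mix mat_trace_two_mix)
  define \<tau> where "\<tau> = Tomography T sel lam (replicate (num_copies lam) \<rho>)"
  define \<tau>' where "\<tau>' = Tomography T sel lam (replicate (num_copies lam) \<sigma>)"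
  obtain R where R: "prob_space \<tau>" "sets \<tau> = sets (option_space (mat_borel ?N))" "R \<in> sets \<tau>"
      "measure \<tau> R \<le> (7 / 8) ^ lam" "\<And>M. Some M \<in> space \<tau> - R \<Longrightarrow> M \<in> carrier_mat ?N ?N \<and> frob_norm (M - \<rho>) \<le> 1 / 27"
    using Tomography_accurate [OF T sel ps(1) [unfolded n] tr(1)] unfolding \<tau>_def n by blast
  obtain R' where R': "prob_space \<tau>'" "sets \<tau>' = sets (option_space (mat_borel ?N))" "R' \<in> sets \<tau>'"
      "measure \<tau>' R' \<le> (7 / 8) ^ lam" "\<And>M. Some M \<in> space \<tau>' - R' \<Longrightarrow> M \<in> carrier_mat ?N ?N \<and> frob_norm (M - \<sigma>) \<le> 1 / 27"
    using Tomography_accurate [OF T sel ps(2) [unfolded n] tr(2)] unfolding \<tau>'_def n by blast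
  have "verdict_of b m m' \<noteq> Valid" if m: "m \<in> space \<tau> - R" "m' \<in> space \<tau>' - R'" for m m'
  proof (cases "m = None \<or> m' = None")
    case True
    then show ?thesis by (cases m; cases m') auto
  next
    case False
    then obtain M M' where M: "m = Some M" "m' = Some M'" by auto
    show ?thesis
      using valid_imp_overlap [OF _ _ ps(1) [THEN proj_sum_carrier] ps(2) [THEN proj_sum_carrier] pure(1,2) _ _ _ q\<rho>,
          of M M'] R(5) [of M] R'(5) [of M'] m q\<sigma> unfolding M by force
  qed
  from bind_verdict_Invalid [OF car(2) R(1,2) R'(1,2) R(3,4) R'(3,4) this]
  have "1 - 2 * (7 / 8) ^ lam \<le> measure (\<tau> \<bind> (\<lambda>m. distr \<tau>' (count_space UNIV) (verdict_of b m))) {Invalid}"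
    by simp
  also have "(\<lambda>m. distr \<tau>' (count_space UNIV) (verdict_of b m)) = Verify T sel Ghat bothat lam (P, k1, x, True)"
    by (rule ext) (simp add: Verify_def b \<tau>'_def \<sigma>_def)
  finally show ?thesis
    unfolding \<tau>_def \<rho>_def by (rule order_trans [rotated]) simp
qed

section \<open>Averaging over the keys and the Pauli\<close>

lemma finite_bitstrings [simp]: "finite (bitstrings m)"
  using finite_lists_length_eq [of "UNIV :: bool set" m] by (simp add: bitstrings_def)

lemma bitstrings_nonempty [simp]: "bitstrings m \<noteq> {}"
  by (simp add: bitstrings_def Ex_list_of_length)

lemma paulis_nonempty [simp]: "paulis n \<noteq> {}"
  using card_paulis [of n] by (auto simp flip: card_0_eq)

text \<open>The Pauli sum is placed innermost because the twirl is applied to a fixed pair of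
  keys.\<close>

lemma expectation_D_dist:
  "measure_pmf.expectation (D_dist lam x) f =
    (\<Sum>k0\<in>bitstrings lam. \<Sum>k1\<in>bitstrings lam. \<Sum>P\<in>paulis (output_len lam).
      f ((P, k0, x, False), (P, k1, x, True))) /
    (4 ^ output_len lam * (real (card (bitstrings lam)))\<^sup>2)"
proof -
  let ?B = "bitstrings lam" and ?A = "paulis (output_len lam)"
  have "measure_pmf.expectation (D_dist lam x) f =
    (\<Sum>P\<in>?A. \<Sum>k0\<in>?B. \<Sum>k1\<in>?B. f ((P, k0, x, False), (P, k1, x, True))) /
    (4 ^ output_len lam * (real (card ?B))\<^sup>2)"
    unfolding D_dist_def
    by (simp add: pmf_expectation_bind_pmf_of_set card_paulis divide_inverse sum_distrib_left
        sum_distrib_right power2_eq_square mult_ac)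
  also have "(\<Sum>P\<in>?A. \<Sum>k0\<in>?B. \<Sum>k1\<in>?B. f ((P, k0, x, False), (P, k1, x, True))) =
      (\<Sum>k0\<in>?B. \<Sum>k1\<in>?B. \<Sum>P\<in>?A. f ((P, k0, x, False), (P, k1, x, True)))"
    by (subst sum.swap, rule sum.cong [OF refl], rule sum.swap)
  finally show ?thesis .
qed

section \<open>Asymptotics of the error\<close>

lemma power_output_len_le: "1 \<le> lam \<Longrightarrow> 2 ^ output_len lam \<le> 2 * real lam ^ 3"
proof -
  assume lam: "1 \<le> lam"
  then have "0 \<le> 3 * log 2 (real lam)" by simp
  \<comment> \<open>The ceiling costs at most 1 in the exponent, hence the factor 2.\<close>
  then have "real (output_len lam) \<le> 3 * log 2 (real lam) + 1"
    unfolding output_len_def by linarith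
  then have "2 powr real (output_len lam) \<le> 2 powr (3 * log 2 (real lam) + 1)"
    by (intro powr_mono) simp_all
  also have "\<dots> = 2 * (2 powr log 2 (real lam)) powr 3"
    by (simp add: powr_add powr_powr mult.commute)
  also have "\<dots> = 2 * real lam ^ 3"
    using lam by (simp add: powr_numeral)
  finally show ?thesis by (simp add: powr_realpow)
qed

lemma geometric_bigo: "(\<lambda>lam. (7 / 8) ^ lam) \<in> O(\<lambda>lam. 1 / 2 ^ output_len lam :: real)"
proof -
  have "(\<lambda>lam. (7 / 8) ^ lam) \<in> O(\<lambda>lam. 1 / real lam ^ 3)"
    by real_asymp
  also have "(\<lambda>lam. 1 / real lam ^ 3) \<in> O(\<lambda>lam. 1 / 2 ^ output_len lam)"
  proof (rule bigoI [where c = 2])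
    show "\<forall>\<^sub>F lam in sequentially. norm (1 / real lam ^ 3) \<le> 2 * norm (1 / 2 ^ output_len lam :: real)"
      using eventually_ge_at_top [of 1]
      by eventually_elim (use power_output_len_le in \<open>simp add: field_simps\<close>)
  qed
  finally show ?thesis .
qed

theorem lemma7p9:
  fixes G Ghat :: "nat \<Rightarrow> qcircuit"
    and bothat :: "nat \<Rightarrow> complex Matrix.vec"
    and T :: tomography
    and sel :: "nat \<Rightarrow> nat \<Rightarrow> nat \<Rightarrow> (nat \<Rightarrow> complex mat) \<Rightarrow> nat"
  assumes "prfs input_len output_len G"
    and "recognizable_abort input_len output_len G Ghat bothat"
    and "tomography_procedure T"
    and "selection_rule sel"
  shows "(\<lambda>lam. real (num_copies lam)) \<in> O(\<lambda>lam. 2 ^ (3 * output_len lam) * real lam)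
    \<and> (\<exists>\<epsilon> :: nat \<Rightarrow> real. \<epsilon> \<in> O(\<lambda>lam. 1 / 2 ^ output_len lam) \<and>
         (\<forall>lam. \<forall>x \<in> bitstrings (input_len lam).
            distributional_different_input_correct
              (Tomography T sel lam) (Verify T sel Ghat bothat lam) (Phi Ghat lam)
              (\<epsilon> lam) (num_copies lam) Pi_pred (D_dist lam x)))"
proof (intro conjI exI allI ballI)
  show "(\<lambda>lam. real (num_copies lam)) \<in> O(\<lambda>lam. 2 ^ (3 * output_len lam) * real lam)"
    by (rule bigoI [where c = "3 ^ 8 * 32"]) (simp add: num_copies_def power_add)
  let ?\<epsilon> = "\<lambda>lam. 2 * (7 / 8) ^ lam + 2 * (1 / 2 ^ output_len lam) :: real"
  show "?\<epsilon> \<in> O(\<lambda>lam. 1 / 2 ^ output_len lam)"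
  proof (rule sum_in_bigo)
    show "(\<lambda>lam. 2 * (1 / 2 ^ output_len lam)) \<in> O(\<lambda>lam. 1 / 2 ^ output_len lam :: real)"
      by (rule bigoI [where c = 2]) simp
  qed (use geometric_bigo in simp)
  fix lam x assume x: "x \<in> bitstrings (input_len lam)"
  let ?n = "output_len lam"
  let ?B = "bitstrings lam"
  let ?K = "real (card ?B)"
  have K: "0 < ?K" by (simp add: card_gt_0_iff)
  from assms(2) have \<beta>: "pure_state (2 ^ ?n) (bothat lam)" by (simp add: recognizable_abort_def)
  \<comment> \<open>\<open>kron_proj\<close> merges the flag projector and the state projector into
    one, which brings the recognizable-abort decomposition into the form
    \<open>two_mix\<close>.\<close>
  have "\<forall>k\<in>?B. \<exists>\<eta> \<psi>. 0 \<le> \<eta> \<and> \<eta> \<le> 1 \<and> pure_state (2 ^ ?n) \<psi> \<and>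
      gen_out Ghat lam k x = two_mix \<eta> (kron_vec (bit_ket False) \<psi>) (abort_state (bothat lam))"
    using assms(2) x unfolding recognizable_abort_def two_mix_def kron_proj by blast
  then obtain \<eta> \<psi> where gen: "\<And>k. k \<in> ?B \<Longrightarrow> 0 \<le> \<eta> k \<and> \<eta> k \<le> 1 \<and> pure_state (2 ^ ?n) (\<psi> k) \<and>
      gen_out Ghat lam k x = two_mix (\<eta> k) (kron_vec (bit_ket False) (\<psi> k)) (abort_state (bothat lam))"
    by metis
  let ?p = "\<lambda>(z, z'). measure (Tomography T sel lam (replicate (num_copies lam) (Phi Ghat lam z))
      \<bind> Verify T sel Ghat bothat lam z') {Invalid}"
  let ?c = "1 - 2 * (7 / 8) ^ lam :: real"
  have avg: "4 ^ ?n * ?c - 2 * 2 ^ ?n \<le> (\<Sum>P\<in>paulis ?n. ?p ((P, k0, x, False), (P, k1, x, True)))"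
    if k: "k0 \<in> ?B" "k1 \<in> ?B" for k0 k1
  proof -
    note g = gen [OF k(1)] gen [OF k(2)]
    have pure: "pure_state (2 ^ ?n) (\<psi> k0)" "pure_state (2 ^ ?n) (\<psi> k1)" using g by auto
    have "(\<Sum>P\<in>paulis ?n. ?c - 2 * (cmod ((pauli_mat P *\<^sub>v \<psi> k1) \<bullet>c \<psi> k0))\<^sup>2) = 4 ^ ?n * ?c - 2 * 2 ^ ?n"
      using pauli_twirl [OF pure(2,1) [THEN pure_stateD(1)]] pure [THEN pure_stateD(3)]
      by (simp add: sum_subtractf card_paulis sum_distrib_left [symmetric])
    moreover have "?c - 2 * (cmod ((pauli_mat P *\<^sub>v \<psi> k1) \<bullet>c \<psi> k0))\<^sup>2 \<le>
        ?p ((P, k0, x, False), (P, k1, x, True))" if "P \<in> paulis ?n" for P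
      using Verify_Invalid [where n = ?n and bothat = bothat and lam = lam, OF assms(3,4) refl that \<beta>, of "\<eta> k0" "\<psi> k0" Ghat k0 x "\<eta> k1" "\<psi> k1" k1] g by simp
    ultimately show ?thesis by (metis (no_types, lifting) sum_mono)
  qed
  \<comment> \<open>The number of key pairs cancels, and the twirl term becomes 2 * 2^n / 4^n = 2 /
    2^n.\<close>
  have "1 - ?\<epsilon> lam = ?K\<^sup>2 * (4 ^ ?n * ?c - 2 * 2 ^ ?n) / (4 ^ ?n * ?K\<^sup>2)"
    using K by (simp add: field_simps power_mult_distrib flip: power_mult_distrib)
  also have "?K\<^sup>2 * (4 ^ ?n * ?c - 2 * 2 ^ ?n) = (\<Sum>k0\<in>?B. \<Sum>k1\<in>?B. 4 ^ ?n * ?c - 2 * 2 ^ ?n)"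
    by (simp add: power2_eq_square)
  also have "\<dots> / (4 ^ ?n * ?K\<^sup>2) \<le> measure_pmf.expectation (D_dist lam x) ?p"
    unfolding expectation_D_dist by (intro divide_right_mono sum_mono avg) simp_all
  finally have "1 - ?\<epsilon> lam \<le> measure_pmf.expectation (D_dist lam x) ?p" .
  moreover have "\<forall>(z, z')\<in>set_pmf (D_dist lam x). Pi_pred z z' = 0"
    by (auto simp: D_dist_def)
  ultimately show "distributional_different_input_correct (Tomography T sel lam) (Verify T sel Ghat bothat lam)
      (Phi Ghat lam) (?\<epsilon> lam) (num_copies lam) Pi_pred (D_dist lam x)"
    unfolding distributional_different_input_correct_def by blast
qed

end
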